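(* Let $X$ be a graph (simple, reflexive, possibly infinite) and let $\mathrm{Id}_{\mathbf{KR}}:|\mathbf K(X)|\to\mathbf R(X)$ be the (continuous) identity map on underlying sets. Then for every $n\ge 0$, $\pi_n(\mathrm{Id}_{\mathbf{KR}}):\pi_n(|\mathbf K(X)|,* )\to\pi_n(\mathbf R(X),* )$ is a monomorphism (for $n=0$: injective).
   Context: Pretopological spaces. A pretopological space is a set $Z$ with, for each $z\in Z$, a filter $\mathcal U_z$ on $Z$ (the neighborhood filter) all of whose members contain $z$; a filter converges to $z$ iff it contains $\mathcal U_z$. A map $f:Z\to W$ is continuous iff $\mathcal U_{f(z)}\subset f(\mathcal U_z)$ for all $z$, where $f(\mathcal U_z)$ is the filter generated by images. Topological spaces are pretopological via their neighborhood filters. In a product a filter converges iff both projections converge. Continuous $f,g:Z\to W$ are homotopic if there is a continuous $H:Z\times[0,1]\to W$ with $H(\cdot,0)=f$, $H(\cdot,1)=g$. $\pi_n(Z,* )$ is the set of based homotopy classes of continuous based maps $(S^n,* )\to(Z,* )$, a group for $n\ge1$ with the usual operation. Graphs. A graph $(X,E)$ is undirected, without multiple edges, and reflexive. The clique complex $\mathbf K(X)$ has as simplices the finite nonempty sets of pairwise adjacent vertices; $|\mathbf K(X)|$ is its geometric realization with the usual (weak) topology, with underlying set $\mathrm U|X|\supset X$; $|\sigma|$ denotes the closed geometric simplex of $\sigma$. The intermediate geometric realization $\mathbf R(X)$ is the pretopological space on the set $\mathrm U|X|$ where the neighborhood filter at a vertex $v\in X$ is the filter of all supersets of $\bigcup\{|\sigma|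 : \sigma\in\mathbf K(X),\ v\in\sigma\}$, and the neighborhood filter at a point of $\mathrm U|X|\setminus X$ is its neighborhood filter in $|\mathbf K(X)|$. The identity map on $\mathrm U|X|$ is continuous as a map $|\mathbf K(X)|\to\mathbf R(X)$. Base points are the same point of $\mathrm U|X|$ on both sides. *)

theory Defs
  imports "HOL-Analysis.Analysis" "HOL-Algebra.Group"
begin

section \<open>Pretopological spaces\<close>

text \<open>A filter on the point set \<open>Z\<close> is represented by a filter on the whole type that contains
  \<open>Z\<close>. Values of \<open>nbhd\<close> outside \<open>points\<close> are irrelevant. Note that the order on Isabelle filters
  is the reverse of inclusion of filters as families of sets.\<close>

record 'a pretop =
  points :: "'a set"
  nbhd :: "'a \<Rightarrow> 'a filter"

definition pretopological_space :: "'a pretop \<Rightarrow> bool" where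
  "pretopological_space Z \<longleftrightarrow>
     (\<forall>z\<in>points Z. eventually (\<lambda>x. x \<in> points Z) (nbhd Z z) \<and>
                   (\<forall>P. eventually P (nbhd Z z) \<longrightarrow> P z))"

text \<open>\<open>filterlim f (nbhd W (f z)) (nbhd Z z)\<close> unfolds to
  \<open>filtermap f (nbhd Z z) \<le> nbhd W (f z)\<close>, i.e. the filter generated by the images of the
  neighborhoods of \<open>z\<close> contains the neighborhood filter of \<open>f z\<close>.\<close>

definition pcontinuous_map :: "'a pretop \<Rightarrow> 'b pretop \<Rightarrow> ('a \<Rightarrow> 'b) \<Rightarrow> bool" where
  "pcontinuous_map Z W f \<longleftrightarrow>
     f \<in> points Z \<rightarrow> points W \<and> (\<forall>z\<in>points Z. filterlim f (nbhd W (f z)) (nbhd Z z))"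

definition pretop_of :: "'a topology \<Rightarrow> 'a pretop" where
  "pretop_of X = \<lparr>points = topspace X, nbhd = nhdsin X\<rparr>"

definition prod_pretop :: "'a pretop \<Rightarrow> 'b pretop \<Rightarrow> ('a \<times> 'b) pretop" where
  "prod_pretop Z W =
     \<lparr>points = points Z \<times> points W, nbhd = (\<lambda>(z, w). nbhd Z z \<times>\<^sub>F nbhd W w)\<rparr>"

lemma pretop_of_simps [simp]:
  "points (pretop_of X) = topspace X" "nbhd (pretop_of X) = nhdsin X"
  by (simp_all add: pretop_of_def)

lemma prod_pretop_simps [simp]:
  "points (prod_pretop Z W) = points Z \<times> points W"
  "nbhd (prod_pretop Z W) (z, w) = nbhd Z z \<times>\<^sub>F nbhd W w"
  by (simp_all add: prod_pretop_def)

lemma pretopological_space_pretop_of: "pretopological_space (pretop_of X)"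
  unfolding pretopological_space_def
  by (auto simp: eventually_nhdsin)

lemma pretopological_space_prod_pretop:
  assumes "pretopological_space Z" "pretopological_space W"
  shows "pretopological_space (prod_pretop Z W)"
  unfolding pretopological_space_def
proof (intro ballI conjI allI impI)
  fix p assume "p \<in> points (prod_pretop Z W)"
  then obtain z w where p: "p = (z, w)" "z \<in> points Z" "w \<in> points W"
    by auto
  show "eventually (\<lambda>x. x \<in> points (prod_pretop Z W)) (nbhd (prod_pretop Z W) p)"
    using assms p unfolding pretopological_space_def
    by (simp add: eventually_prod_filter) blast
  fix P assume "eventually P (nbhd (prod_pretop Z W) p)"
  then obtain A B where "eventually A (nbhd Z z)" "eventually B (nbhd W w)"
    "\<And>x y. A x \<Longrightarrow> B y \<Longrightarrow> P (x, y)"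
    using p by (auto simp: eventually_prod_filter)
  then show "P p"
    using assms p unfolding pretopological_space_def by blast
qed

lemma pcontinuous_map_pretop_of:
  "pcontinuous_map (pretop_of X) (pretop_of Y) f \<longleftrightarrow> continuous_map X Y f"
proof
  assume L: "pcontinuous_map (pretop_of X) (pretop_of Y) f"
  show "continuous_map X Y f"
    unfolding continuous_map_def
  proof (intro conjI allI impI)
    show "f \<in> topspace X \<rightarrow> topspace Y"
      using L by (simp add: pcontinuous_map_def)
    fix U assume U: "openin Y U"
    have "\<exists>T. openin X T \<and> x \<in> T \<and> T \<subseteq> {x \<in> topspace X. f x \<in> U}"
      if x: "x \<in> topspace X" "f x \<in> U" for x
    proof -
      have "filterlim f (nhdsin Y (f x)) (nhdsin X x)"
        using L that by (simp add: pcontinuous_map_def)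
      moreover have "eventually (\<lambda>y. y \<in> U) (nhdsin Y (f x))"
        using U that by (auto simp: eventually_nhdsin)
      ultimately have "eventually (\<lambda>y. f y \<in> U) (nhdsin X x)"
        using eventually_compose_filterlim by blast
      then obtain T where "openin X T" "x \<in> T" "\<forall>y\<in>T. f y \<in> U"
        using x by (auto simp: eventually_nhdsin)
      then show ?thesis
        using openin_subset by blast
    qed
    then show "openin X {x \<in> topspace X. f x \<in> U}"
      by (subst openin_subopen) auto
  qed
next
  assume R: "continuous_map X Y f"
  show "pcontinuous_map (pretop_of X) (pretop_of Y) f"
    unfolding pcontinuous_map_def
  proof (intro conjI ballI)
    show "f \<in> points (pretop_of X) \<rightarrow> points (pretop_of Y)"
      using R by (simp add: continuous_map_def)
    fix x assume x: "x \<in> points (pretop_of X)"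
    show "filterlim f (nbhd (pretop_of Y) (f x)) (nbhd (pretop_of X) x)"
      unfolding filterlim_iff
    proof (intro allI impI)
      fix P assume "eventually P (nbhd (pretop_of Y) (f x))"
      then obtain U where U: "openin Y U" "f x \<in> U" "\<forall>y\<in>U. P y"
        using R x by (auto simp: eventually_nhdsin continuous_map_def)
      have "openin X {x \<in> topspace X. f x \<in> U}"
        using R U by (simp add: continuous_map_def)
      then show "eventually (\<lambda>x. P (f x)) (nbhd (pretop_of X) x)"
        using U x by (auto simp: eventually_nhdsin intro!: exI[of _ "{x \<in> topspace X. f x \<in> U}"])
    qed
  qed
qed

section \<open>Homotopy groups\<close>

definition punit_interval :: "real pretop" where
  "punit_interval = pretop_of (top_of_set {0..1})"

definition psphere :: "nat \<Rightarrow> (nat \<Rightarrow> real) pretop" where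
  "psphere n = pretop_of (nsphere n)"

text \<open>The base point \<open>(1, 0, \<dots>, 0)\<close> of every sphere.\<close>

definition sphere_base :: "nat \<Rightarrow> real" where
  "sphere_base = (\<lambda>i. if i = 0 then 1 else 0)"

definition based_maps :: "nat \<Rightarrow> 'b pretop \<Rightarrow> 'b \<Rightarrow> ((nat \<Rightarrow> real) \<Rightarrow> 'b) set" where
  "based_maps n Z z = {f. pcontinuous_map (psphere n) Z f \<and> f sphere_base = z}"

text \<open>Members of \<open>based_maps n Z z\<close> are HOL functions on the whole type; two of them that agree
  on the sphere are always related by \<open>based_homotopy_rel\<close>, so classes do not depend on values
  off the sphere.\<close>

definition based_homotopy_rel ::
  "nat \<Rightarrow> 'b pretop \<Rightarrow> 'b \<Rightarrow> (((nat \<Rightarrow> real) \<Rightarrow> 'b) \<times> ((nat \<Rightarrow> real) \<Rightarrow> 'b)) set" where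
  "based_homotopy_rel n Z z =
     {(f, g). f \<in> based_maps n Z z \<and> g \<in> based_maps n Z z \<and>
        (\<exists>H. pcontinuous_map (prod_pretop (psphere n) punit_interval) Z H \<and>
             (\<forall>x\<in>points (psphere n). H (x, 0) = f x) \<and>
             (\<forall>x\<in>points (psphere n). H (x, 1) = g x) \<and>
             (\<forall>t\<in>{0..1}. H (sphere_base, t) = z))}"

text \<open>The pinch map \<open>S\<^sup>n \<rightarrow> S\<^sup>n \<or> S\<^sup>n\<close> (\<open>n \<ge> 1\<close>) collapses the equator \<open>x n = 0\<close>, which contains the
  base point. On the hemisphere \<open>x n \<ge> 0\<close> it doubles the angle from the north pole,
  \<open>x \<mapsto> 2 (x n) x - e\<^sub>n\<close>, sending the equator to \<open>- e\<^sub>n\<close>, and then applies the rotation of the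
  \<open>(0, n)\<close>-plane with \<open>- e\<^sub>n \<mapsto> e\<^sub>0\<close>. On \<open>x n \<le> 0\<close> it is preceded by the rotation by \<open>\<pi>\<close> in the
  \<open>(0, n)\<close>-plane, which exchanges the hemispheres. Hence both halves have degree one. For \<open>n = 1\<close>
  this is \<open>(cos \<theta>, sin \<theta>) \<mapsto> (cos 2\<theta>, sin 2\<theta>)\<close>, giving concatenation of loops.\<close>

definition sphere_pinch :: "nat \<Rightarrow> (nat \<Rightarrow> real) \<Rightarrow> (nat \<Rightarrow> real)" where
  "sphere_pinch n x =
     (\<lambda>i. if i = 0 then 1 - 2 * (x n)\<^sup>2
          else if i = n then 2 * x n * x 0
          else 2 * \<bar>x n\<bar> * x i)"

definition sphere_map_mult ::
  "nat \<Rightarrow> ((nat \<Rightarrow> real) \<Rightarrow> 'b) \<Rightarrow> ((nat \<Rightarrow> real) \<Rightarrow> 'b) \<Rightarrow> (nat \<Rightarrow> real) \<Rightarrow> 'b" where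
  "sphere_map_mult n f g x =
     (if 0 \<le> x n then f (sphere_pinch n x) else g (sphere_pinch n x))"

text \<open>For \<open>n = 0\<close> only the carrier and the distinguished element \<open>\<one>\<close> are meaningful.\<close>

definition homotopy_group :: "nat \<Rightarrow> 'b pretop \<Rightarrow> 'b \<Rightarrow> ((nat \<Rightarrow> real) \<Rightarrow> 'b) set monoid" where
  "homotopy_group n Z z =
     \<lparr>carrier = based_maps n Z z // based_homotopy_rel n Z z,
      mult = (\<lambda>A B. \<Union>f\<in>A. \<Union>g\<in>B. based_homotopy_rel n Z z `` {sphere_map_mult n f g}),
      one = based_homotopy_rel n Z z `` {\<lambda>x. z}\<rparr>"

text \<open>The map induced on homotopy by a continuous \<open>\<phi>\<close> into \<open>W\<close>; \<open>w\<close> is the base point of \<open>W\<close>,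
  the image under \<open>\<phi>\<close> of that of the source.\<close>

definition homotopy_map ::
  "nat \<Rightarrow> 'c pretop \<Rightarrow> 'c \<Rightarrow> ('b \<Rightarrow> 'c) \<Rightarrow> ((nat \<Rightarrow> real) \<Rightarrow> 'b) set \<Rightarrow> ((nat \<Rightarrow> real) \<Rightarrow> 'c) set" where
  "homotopy_map n W w \<phi> A = (\<Union>f\<in>A. based_homotopy_rel n W w `` {\<phi> \<circ> f})"

lemma sphere_base_in_psphere: "sphere_base \<in> points (psphere n)"
  by (simp add: psphere_def nsphere sphere_base_def if_distrib power2_eq_square cong: if_cong)

lemma sphere_pinch_in_psphere:
  assumes n: "1 \<le> n" and x: "x \<in> points (psphere n)"
  shows "sphere_pinch n x \<in> points (psphere n)"
proof -
  have x1: "(\<Sum>i\<le>n. (x i)\<^sup>2) = 1" and x0: "\<And>i. i > n \<Longrightarrow> x i = 0"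
    using x by (auto simp: psphere_def nsphere)
  have split: "(\<Sum>i\<le>n. h i) = h 0 + h n + (\<Sum>i\<in>{1..<n}. h i)" for h :: "nat \<Rightarrow> real"
  proof -
    have "{..n} = insert 0 (insert n {1..<n})" using n by auto
    then show ?thesis using n by simp
  qed
  have "(\<Sum>i\<in>{1..<n}. (sphere_pinch n x i)\<^sup>2) = (\<Sum>i\<in>{1..<n}. 4 * (x n)\<^sup>2 * (x i)\<^sup>2)"
    by (rule sum.cong) (auto simp: sphere_pinch_def power_mult_distrib)
  also have "\<dots> = 4 * (x n)\<^sup>2 * (1 - (x 0)\<^sup>2 - (x n)\<^sup>2)"
    using x1 split[of "\<lambda>i. (x i)\<^sup>2"] by (simp add: sum_distrib_left [symmetric])
  finally have "(\<Sum>i\<le>n. (sphere_pinch n x i)\<^sup>2) = 1"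
    using n by (subst split) (simp add: sphere_pinch_def power2_eq_square algebra_simps)
  moreover have "\<forall>i>n. sphere_pinch n x i = 0"
    using n x0 by (auto simp: sphere_pinch_def)
  ultimately show ?thesis
    by (auto simp: psphere_def nsphere)
qed

lemma sphere_pinch_equator: "x n = 0 \<Longrightarrow> sphere_pinch n x = sphere_base"
  by (auto simp: sphere_pinch_def sphere_base_def)

section \<open>Graphs, clique complexes and their realizations\<close>

text \<open>Vertex set \<open>V\<close>, adjacency relation \<open>E\<close>.\<close>

locale reflexive_graph =
  fixes V :: "'a set" and E :: "('a \<times> 'a) set"
  assumes edges: "E \<subseteq> V \<times> V"
    and refl_edges: "refl_on V E"
    and sym_edges: "sym E"

definition clique_complex :: "'a set \<Rightarrow> ('a \<times> 'a) set \<Rightarrow> 'a set set" where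
  "clique_complex V E =
     {\<sigma>. finite \<sigma> \<and> \<sigma> \<noteq> {} \<and> \<sigma> \<subseteq> V \<and> (\<forall>u\<in>\<sigma>. \<forall>v\<in>\<sigma>. u \<noteq> v \<longrightarrow> (u, v) \<in> E)}"

text \<open>Points of a realization are given by their barycentric coordinates.\<close>

definition closed_simplex :: "'a set \<Rightarrow> ('a \<Rightarrow> real) set" where
  "closed_simplex \<sigma> = {x. (\<forall>v. 0 \<le> x v) \<and> (\<forall>v. v \<notin> \<sigma> \<longrightarrow> x v = 0) \<and> sum x \<sigma> = 1}"

definition vertex_point :: "'a \<Rightarrow> 'a \<Rightarrow> real" where
  "vertex_point v = (\<lambda>w. if w = v then 1 else 0)"

definition realization_points :: "'a set set \<Rightarrow> ('a \<Rightarrow> real) set" where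
  "realization_points K = (\<Union>\<sigma>\<in>K. closed_simplex \<sigma>)"

text \<open>The weak topology: a set is open iff its trace on every closed simplex is. Since coordinates
  outside the finite set \<open>\<sigma>\<close> vanish, the topology that \<open>closed_simplex \<sigma>\<close> inherits from the product
  topology on \<open>'a \<Rightarrow> real\<close> is the Euclidean one.\<close>

definition geometric_realization :: "'a set set \<Rightarrow> ('a \<Rightarrow> real) topology" where
  "geometric_realization K = topology (\<lambda>U. U \<subseteq> realization_points K \<and>
     (\<forall>\<sigma>\<in>K. openin (top_of_set (closed_simplex \<sigma>)) (U \<inter> closed_simplex \<sigma>)))"

lemma openin_geometric_realization:
  "openin (geometric_realization K) U \<longleftrightarrow> U \<subseteq> realization_points K \<and>
     (\<forall>\<sigma>\<in>K. openin (top_of_set (closed_simplex \<sigma>)) (U \<inter> closed_simplex \<sigma>))"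
proof -
  have "istopology (\<lambda>U. U \<subseteq> realization_points K \<and>
     (\<forall>\<sigma>\<in>K. openin (top_of_set (closed_simplex \<sigma>)) (U \<inter> closed_simplex \<sigma>)))"
    unfolding istopology_def
  proof (rule conjI; intro allI impI)
    fix S T assume S: "S \<subseteq> realization_points K \<and>
        (\<forall>\<sigma>\<in>K. openin (top_of_set (closed_simplex \<sigma>)) (S \<inter> closed_simplex \<sigma>))"
      and T: "T \<subseteq> realization_points K \<and>
        (\<forall>\<sigma>\<in>K. openin (top_of_set (closed_simplex \<sigma>)) (T \<inter> closed_simplex \<sigma>))"
    have "S \<inter> T \<inter> closed_simplex \<sigma> = (S \<inter> closed_simplex \<sigma>) \<inter> (T \<inter> closed_simplex \<sigma>)" for \<sigma>
      by blast
    then show "S \<inter> T \<subseteq> realization_points K \<and>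
        (\<forall>\<sigma>\<in>K. openin (top_of_set (closed_simplex \<sigma>)) (S \<inter> T \<inter> closed_simplex \<sigma>))"
      using S T by (metis inf.coboundedI1 openin_Int)
  next
    fix \<U> assume U: "\<forall>S\<in>\<U>. S \<subseteq> realization_points K \<and>
        (\<forall>\<sigma>\<in>K. openin (top_of_set (closed_simplex \<sigma>)) (S \<inter> closed_simplex \<sigma>))"
    show "\<Union>\<U> \<subseteq> realization_points K \<and>
        (\<forall>\<sigma>\<in>K. openin (top_of_set (closed_simplex \<sigma>)) (\<Union>\<U> \<inter> closed_simplex \<sigma>))"
    proof (intro conjI ballI)
      show "\<Union>\<U> \<subseteq> realization_points K"
        using U by blast
      fix \<sigma> assume "\<sigma> \<in> K"
      then have "openin (top_of_set (closed_simplex \<sigma>)) (\<Union>S\<in>\<U>. S \<inter> closed_simplex \<sigma>)"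
        using U by (intro openin_Union) blast
      then show "openin (top_of_set (closed_simplex \<sigma>)) (\<Union>\<U> \<inter> closed_simplex \<sigma>)"
        by (simp only: Int_Union2)
    qed
  qed
  then show ?thesis
    by (simp add: geometric_realization_def)
qed

lemma topspace_geometric_realization [simp]:
  "topspace (geometric_realization K) = realization_points K"
proof
  show "topspace (geometric_realization K) \<subseteq> realization_points K"
    using openin_geometric_realization openin_topspace by blast
  have "realization_points K \<inter> closed_simplex \<sigma> = closed_simplex \<sigma>" if "\<sigma> \<in> K" for \<sigma>
    using that by (auto simp: realization_points_def)
  then have "openin (geometric_realization K) (realization_points K)"
    by (auto simp: openin_geometric_realization)
  then show "realization_points K \<subseteq> topspace (geometric_realization K)"
    by (rule openin_subset)
qed

definition clique_realization :: "'a set \<Rightarrow> ('a \<times> 'a) set \<Rightarrow> ('a \<Rightarrow> real) pretop" where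
  "clique_realization V E = pretop_of (geometric_realization (clique_complex V E))"

text \<open>The intermediate realization; \<open>vertex_point ` V\<close> is the vertex set as a set of points.\<close>

definition intermediate_realization :: "'a set \<Rightarrow> ('a \<times> 'a) set \<Rightarrow> ('a \<Rightarrow> real) pretop" where
  "intermediate_realization V E =
     \<lparr>points = realization_points (clique_complex V E),
      nbhd = (\<lambda>x. if x \<in> vertex_point ` V
                   then principal (\<Union>{closed_simplex \<sigma> | \<sigma>.
                          \<sigma> \<in> clique_complex V E \<and> (\<exists>v\<in>\<sigma>. x = vertex_point v)})
                   else nhdsin (geometric_realization (clique_complex V E)) x)\<rparr>"

lemma vertex_point_in_closed_simplex:
  "finite \<sigma> \<Longrightarrow> v \<in> \<sigma> \<Longrightarrow> vertex_point v \<in> closed_simplex \<sigma>"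
  by (auto simp: vertex_point_def closed_simplex_def)

lemma pretopological_space_intermediate_realization:
  "pretopological_space (intermediate_realization V E)"
  unfolding pretopological_space_def
proof (intro ballI conjI allI impI)
  let ?K = "clique_complex V E"
  fix x assume x: "x \<in> points (intermediate_realization V E)"
  show "eventually (\<lambda>y. y \<in> points (intermediate_realization V E)) (nbhd (intermediate_realization V E) x)"
  proof (cases "x \<in> vertex_point ` V")
    case True
    then show ?thesis
      by (auto simp: intermediate_realization_def eventually_principal realization_points_def)
  next
    case False
    then show ?thesis
      by (auto simp: intermediate_realization_def eventually_nhdsin)
  qed
  fix P assume P: "eventually P (nbhd (intermediate_realization V E) x)"
  show "P x"
  proof (cases "x \<in> vertex_point ` V")
    case True
    then obtain v where v: "v \<in> V" "x = vertex_point v" by blast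
    then have "{v} \<in> ?K" by (auto simp: clique_complex_def)
    moreover have "x \<in> closed_simplex {v}"
      unfolding v(2) by (rule vertex_point_in_closed_simplex) auto
    ultimately have "x \<in> \<Union>{closed_simplex \<sigma> | \<sigma>. \<sigma> \<in> ?K \<and> (\<exists>v\<in>\<sigma>. x = vertex_point v)}"
      by (intro UnionI[of "closed_simplex {v}"]) (use v(2) in blast)
    moreover have "\<forall>y\<in>\<Union>{closed_simplex \<sigma> | \<sigma>. \<sigma> \<in> ?K \<and> (\<exists>v\<in>\<sigma>. x = vertex_point v)}. P y"
      using P True by (simp add: intermediate_realization_def eventually_principal)
    ultimately show ?thesis
      by (rule bspec [rotated])
  next
    case False
    then show ?thesis
      using P x by (auto simp: intermediate_realization_def eventually_nhdsin)
  qed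
qed

lemma pcontinuous_map_id_KR:
  "pcontinuous_map (clique_realization V E) (intermediate_realization V E) id"
  unfolding pcontinuous_map_def
proof (intro conjI ballI)
  let ?K = "clique_complex V E"
  show "id \<in> points (clique_realization V E) \<rightarrow> points (intermediate_realization V E)"
    by (simp add: clique_realization_def intermediate_realization_def)
  fix x assume x: "x \<in> points (clique_realization V E)"
  show "filterlim id (nbhd (intermediate_realization V E) (id x)) (nbhd (clique_realization V E) x)"
  proof (cases "x \<in> vertex_point ` V")
    case False
    then show ?thesis
      by (simp add: clique_realization_def intermediate_realization_def filterlim_def)
  next
    case True
    then obtain v where v: "x = vertex_point v" by blast
    define U where "U = {y \<in> realization_points ?K. y v > 0}"
    have "open {y :: 'a \<Rightarrow> real. y v > 0}"
      by (intro open_Collect_less continuous_on_const continuous_on_product_coordinates)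
    moreover have "U \<inter> closed_simplex \<sigma> = closed_simplex \<sigma> \<inter> {y. y v > 0}" if "\<sigma> \<in> ?K" for \<sigma>
      using that by (auto simp: U_def realization_points_def)
    ultimately have "openin (geometric_realization ?K) U"
      by (auto simp: openin_geometric_realization U_def openin_open_Int)
    moreover have "x \<in> U"
      using x v by (simp add: U_def clique_realization_def vertex_point_def)
    moreover have "U \<subseteq> \<Union>{closed_simplex \<sigma> | \<sigma>. \<sigma> \<in> ?K \<and> (\<exists>v\<in>\<sigma>. x = vertex_point v)}"
    proof
      fix y assume "y \<in> U"
      then obtain \<sigma> where s: "\<sigma> \<in> ?K" "y \<in> closed_simplex \<sigma>" "y v > 0"
        by (auto simp: U_def realization_points_def)
      then have "v \<in> \<sigma>"
        by (force simp: closed_simplex_def)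
      then show "y \<in> \<Union>{closed_simplex \<sigma> | \<sigma>. \<sigma> \<in> ?K \<and> (\<exists>v\<in>\<sigma>. x = vertex_point v)}"
        using s v by blast
    qed
    ultimately have "eventually (\<lambda>y. y \<in> \<Union>{closed_simplex \<sigma> | \<sigma>. \<sigma> \<in> ?K \<and>
        (\<exists>v\<in>\<sigma>. x = vertex_point v)}) (nhdsin (geometric_realization ?K) x)"
      unfolding eventually_nhdsin by blast
    then show ?thesis
      using True by (simp add: clique_realization_def intermediate_realization_def filterlim_principal)
  qed
qed

end

(* Let H be a based homotopy S^n x [0,1] -> R(X) between maps that are continuous into |K(X)|. Every
   point z of the cylinder has a radius r(z) such that, for dist z w < r(z), the supports of H(z) and
   H(w) span a common simplex: at a vertex this is the definition of its neighborhood filter, and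
   elsewhere supports can only grow nearby. Cover the cylinder by finitely many balls of radius
   r(z)/2 and put G(w) = sum of lambda_z(w) H(z) for a subordinate partition of unity. If two of the
   balls meet, the larger full ball contains the center of the other one, so the supports of H at
   the two centers span a simplex. As K(X) is a flag complex, H(w) and all H(z) that contribute to
   G(w) lie in one simplex. Hence G is continuous into |K(X)|, the ends of H are joined to those of G
   by straight lines, and G is based as soon as the balls centered off the base line avoid it. *)

theory Submission
  imports Defs
begin

section \<open>Homotopy of maps into pretopological spaces\<close>

lemma pcontinuous_map_compose:
  assumes "pcontinuous_map X Y f" "pcontinuous_map Y Z g"
  shows "pcontinuous_map X Z (g \<circ> f)"
  unfolding pcontinuous_map_def
proof (intro conjI ballI)
  show "g \<circ> f \<in> points X \<rightarrow> points Z"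
    using assms by (auto simp: pcontinuous_map_def Pi_iff)
  fix x assume x: "x \<in> points X"
  then have "f x \<in> points Y" "filterlim f (nbhd Y (f x)) (nbhd X x)"
    using assms(1) unfolding pcontinuous_map_def by blast+
  moreover from this have "filterlim g (nbhd Z (g (f x))) (nbhd Y (f x))"
    using assms(2) unfolding pcontinuous_map_def by blast
  ultimately show "filterlim (g \<circ> f) (nbhd Z ((g \<circ> f) x)) (nbhd X x)"
    unfolding comp_def by (blast intro: filterlim_compose)
qed

text \<open>Where \<open>p\<close> is nonzero, one of the two branches agrees with the glued map on
  a whole neighborhood. Where \<open>p\<close> vanishes, \<open>f x = g x\<close>, so both branches
  tend to the same filter \<open>nbhd W (f x)\<close>. The argument is pointwise with filters, since
  \<open>W\<close> is an arbitrary \<open>pretop\<close> and need not come from a topology.\<close>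

lemma pcontinuous_map_glue:
  fixes p :: "'a \<Rightarrow> real"
  assumes f: "pcontinuous_map (pretop_of X) W f" and g: "pcontinuous_map (pretop_of X) W g"
    and p: "continuous_map X euclideanreal p"
    and eq: "\<And>x. x \<in> topspace X \<Longrightarrow> p x = 0 \<Longrightarrow> f x = g x"
  shows "pcontinuous_map (pretop_of X) W (\<lambda>x. if 0 \<le> p x then f x else g x)"
  unfolding pcontinuous_map_def
proof (intro conjI ballI)
  let ?h = "\<lambda>x. if 0 \<le> p x then f x else g x"
  show "?h \<in> points (pretop_of X) \<rightarrow> points W"
    using f g by (auto simp: pcontinuous_map_def Pi_iff)
  fix x assume "x \<in> points (pretop_of X)"
  then have x: "x \<in> topspace X" by simp
  have fl: "filterlim f (nbhd W (f x)) (nhdsin X x)" and gl: "filterlim g (nbhd W (g x)) (nhdsin X x)"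
    using f g x unfolding pcontinuous_map_def pretop_of_simps by blast+
  have *: "eventually (\<lambda>y. p y \<in> U) (nhdsin X x)" if "open U" "p x \<in> U" for U
    unfolding eventually_nhdsin
    using openin_continuous_map_preimage[OF p, of U] that x
    by (intro disjI2 exI[of _ "{y \<in> topspace X. p y \<in> U}"]) auto
  consider "p x > 0" | "p x < 0" | "p x = 0" by linarith
  then show "filterlim ?h (nbhd W (?h x)) (nbhd (pretop_of X) x)"
  proof cases
    case 1
    have "eventually (\<lambda>y. f y = ?h y) (nhdsin X x)"
      using *[of "{0<..}"] 1 by (auto elim: eventually_mono)
    then show ?thesis
      using filterlim_cong[OF refl refl, of f ?h "nhdsin X x" "nbhd W (f x)"] fl 1 by simp
  next
    case 2
    have "eventually (\<lambda>y. g y = ?h y) (nhdsin X x)"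
      using *[of "{..<0}"] 2 by (auto elim: eventually_mono)
    then show ?thesis
      using filterlim_cong[OF refl refl, of g ?h "nhdsin X x" "nbhd W (g x)"] gl 2 by simp
  next
    case 3
    then have "filterlim ?h (nbhd W (f x)) (nhdsin X x)"
      using fl gl eq[OF x 3] by (intro filterlim_If) (auto intro: filterlim_mono)
    then show ?thesis
      using 3 by simp
  qed
qed

text \<open>Open rectangles form a base of the product topology. This turns the domain of a homotopy
  into a topological space, so that only the target remains pretopological.\<close>

lemma prod_pretop_pretop_of:
  "prod_pretop (pretop_of X) (pretop_of Y) = pretop_of (prod_topology X Y)"
proof -
  have "nhdsin X x \<times>\<^sub>F nhdsin Y y = nhdsin (prod_topology X Y) (x, y)" for x y
  proof (cases "x \<in> topspace X \<and> y \<in> topspace Y")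
    case True
    show ?thesis
    proof (intro filter_eq_iff[THEN iffD2] allI iffI)
      fix P assume "eventually P (nhdsin X x \<times>\<^sub>F nhdsin Y y)"
      then obtain Q R where "eventually Q (nhdsin X x)" "eventually R (nhdsin Y y)"
        and QR: "\<And>a b. Q a \<Longrightarrow> R b \<Longrightarrow> P (a, b)"
        unfolding eventually_prod_filter by blast
      then obtain U U' where U: "openin X U" "x \<in> U" "\<forall>a\<in>U. Q a"
          and U': "openin Y U'" "y \<in> U'" "\<forall>a\<in>U'. R a"
        using True unfolding eventually_nhdsin by blast
      have "openin (prod_topology X Y) (U \<times> U')"
        using U(1) U'(1) by (simp add: openin_prod_Times_iff)
      moreover have "(x, y) \<in> U \<times> U'" "\<forall>a\<in>U \<times> U'. P a"
        using U U' QR by auto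
      ultimately show "eventually P (nhdsin (prod_topology X Y) (x, y))"
        unfolding eventually_nhdsin by blast
    next
      fix P assume "eventually P (nhdsin (prod_topology X Y) (x, y))"
      then obtain S where "openin (prod_topology X Y) S" "(x, y) \<in> S" "\<forall>a\<in>S. P a"
        using True unfolding eventually_nhdsin by auto
      moreover from this obtain U U' where "openin X U" "x \<in> U" "openin Y U'" "y \<in> U'" "U \<times> U' \<subseteq> S"
        unfolding openin_prod_topology_alt by meson
      ultimately have "eventually (\<lambda>a. a \<in> U) (nhdsin X x)" "eventually (\<lambda>a. a \<in> U') (nhdsin Y y)"
          "\<And>a b. a \<in> U \<Longrightarrow> b \<in> U' \<Longrightarrow> P (a, b)"
        unfolding eventually_nhdsin by blast+
      then show "eventually P (nhdsin X x \<times>\<^sub>F nhdsin Y y)"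
        unfolding eventually_prod_filter by blast
    qed
  next
    case False
    \<comment> \<open>Outside the underlying set \<open>nhdsin\<close> is the trivial filter
      \<open>bot\<close>, so both sides are \<open>bot\<close>.\<close>
    then show ?thesis by (auto simp: prod_filter_eq_bot)
  qed
  then show ?thesis
    by (auto simp: prod_pretop_def pretop_of_def fun_eq_iff)
qed

section \<open>Based homotopy as an equivalence relation\<close>

text \<open>The domain of homotopies is kept as a topology, so that reparametrizations are ordinary
  continuous maps, transferred by \<open>pcontinuous_map_pretop_of\<close>.\<close>

definition sphere_cylinder :: "nat \<Rightarrow> ((nat \<Rightarrow> real) \<times> real) topology" where
  "sphere_cylinder n = prod_topology (nsphere n) (top_of_set {0..1})"

lemma topspace_sphere_cylinder [simp]:
  "topspace (sphere_cylinder n) = topspace (nsphere n) \<times> {0..1}"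
  by (simp add: sphere_cylinder_def)

lemma sphere_base_in_nsphere: "sphere_base \<in> topspace (nsphere n)"
  using sphere_base_in_psphere[of n] by (simp add: psphere_def)

lemma based_homotopy_rel_iff:
  "(f, g) \<in> based_homotopy_rel n Z z \<longleftrightarrow> f \<in> based_maps n Z z \<and> g \<in> based_maps n Z z \<and>
     (\<exists>H. pcontinuous_map (pretop_of (sphere_cylinder n)) Z H \<and>
          (\<forall>x\<in>topspace (nsphere n). H (x, 0) = f x) \<and>
          (\<forall>x\<in>topspace (nsphere n). H (x, 1) = g x) \<and>
          (\<forall>t\<in>{0..1}. H (sphere_base, t) = z))"
  unfolding based_homotopy_rel_def sphere_cylinder_def psphere_def punit_interval_def
    prod_pretop_pretop_of by simp

lemma based_maps_iff:
  "f \<in> based_maps n Z z \<longleftrightarrow> pcontinuous_map (pretop_of (nsphere n)) Z f \<and> f sphere_base = z"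
  by (simp add: based_maps_def psphere_def)

lemma continuous_map_fst_sphere_cylinder: "continuous_map (sphere_cylinder n) (nsphere n) fst"
  by (simp add: sphere_cylinder_def continuous_map_fst)

lemma continuous_map_snd_sphere_cylinder: "continuous_map (sphere_cylinder n) euclideanreal snd"
  unfolding sphere_cylinder_def
  using continuous_map_snd continuous_map_into_fulltopology by blast

text \<open>Serves to reverse and to concatenate homotopies. Time changes are continuous on the
  whole line and preserve the unit interval; piecewise ones are therefore written with
  \<open>min\<close> and \<open>max\<close>.\<close>

lemma pcontinuous_map_reparametrize:
  fixes p :: "real \<Rightarrow> real"
  assumes "pcontinuous_map (pretop_of (sphere_cylinder n)) Z H"
    and p: "continuous_on UNIV p" "p ` {0..1} \<subseteq> {0..1}"
  shows "pcontinuous_map (pretop_of (sphere_cylinder n)) Z (\<lambda>y. H (fst y, p (snd y)))"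
proof -
  have "continuous_map (sphere_cylinder n) euclideanreal (p \<circ> snd)"
    by (rule continuous_map_compose[OF continuous_map_snd_sphere_cylinder]) (use p(1) in simp)
  then have "continuous_map (sphere_cylinder n) (top_of_set {0..1}) (\<lambda>y. p (snd y))"
    using p(2) by (auto simp: continuous_map_in_subtopology comp_def image_subset_iff)
  then have "continuous_map (sphere_cylinder n) (sphere_cylinder n) (\<lambda>y. (fst y, p (snd y)))"
    using continuous_map_fst_sphere_cylinder[of n]
    by (subst (2) sphere_cylinder_def) (simp add: continuous_map_pairwise comp_def)
  from pcontinuous_map_compose[OF this[folded pcontinuous_map_pretop_of] assms(1)]
  show ?thesis by (simp add: comp_def)
qed

lemma equiv_based_homotopy_rel: "equiv (based_maps n Z z) (based_homotopy_rel n Z z)"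
proof (rule equivI)
  show "based_homotopy_rel n Z z \<subseteq> based_maps n Z z \<times> based_maps n Z z"
    by (auto simp: based_homotopy_rel_iff)
  show "refl_on (based_maps n Z z) (based_homotopy_rel n Z z)"
  proof (rule refl_onI)
    fix f assume f: "f \<in> based_maps n Z z"
    then have *: "pcontinuous_map (pretop_of (sphere_cylinder n)) Z (f \<circ> fst)"
      using continuous_map_fst_sphere_cylinder pcontinuous_map_compose
      by (metis based_maps_iff pcontinuous_map_pretop_of)
    show "(f, f) \<in> based_homotopy_rel n Z z"
      using f unfolding based_homotopy_rel_iff
      by (intro conjI exI[of _ "f \<circ> fst"] *) (simp_all add: based_maps_iff)
  qed
  show "sym (based_homotopy_rel n Z z)"
  proof (rule symI)
    fix f g assume "(f, g) \<in> based_homotopy_rel n Z z"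
    then obtain H where fg: "f \<in> based_maps n Z z" "g \<in> based_maps n Z z"
      and H: "pcontinuous_map (pretop_of (sphere_cylinder n)) Z H"
        "\<forall>x\<in>topspace (nsphere n). H (x, 0) = f x" "\<forall>x\<in>topspace (nsphere n). H (x, 1) = g x"
        "\<forall>t\<in>{0..1}. H (sphere_base, t) = z"
      by (auto simp: based_homotopy_rel_iff)
    have "pcontinuous_map (pretop_of (sphere_cylinder n)) Z (\<lambda>y. H (fst y, 1 - snd y))"
      by (rule pcontinuous_map_reparametrize[OF H(1)]) (auto intro!: continuous_intros)
    then show "(g, f) \<in> based_homotopy_rel n Z z"
      unfolding based_homotopy_rel_iff using fg H(2-4)
      by (intro conjI exI[of _ "\<lambda>y. H (fst y, 1 - snd y)"]) simp_all
  qed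
  show "trans (based_homotopy_rel n Z z)"
  proof (rule transI)
    fix f g h assume "(f, g) \<in> based_homotopy_rel n Z z" "(g, h) \<in> based_homotopy_rel n Z z"
    then obtain H G where fg: "f \<in> based_maps n Z z" "h \<in> based_maps n Z z"
      and H: "pcontinuous_map (pretop_of (sphere_cylinder n)) Z H"
        "\<forall>x\<in>topspace (nsphere n). H (x, 0) = f x" "\<forall>x\<in>topspace (nsphere n). H (x, 1) = g x"
        "\<forall>t\<in>{0..1}. H (sphere_base, t) = z"
      and G: "pcontinuous_map (pretop_of (sphere_cylinder n)) Z G"
        "\<forall>x\<in>topspace (nsphere n). G (x, 0) = g x" "\<forall>x\<in>topspace (nsphere n). G (x, 1) = h x"
        "\<forall>t\<in>{0..1}. G (sphere_base, t) = z"
      unfolding based_homotopy_rel_iff by blast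
    \<comment> \<open>Concatenation at double speed. The clamps keep each time change inside the
      unit interval also on the half where its branch is not selected. At time 1/2 the branches
      agree: \<open>H\<close> ends and \<open>G\<close> starts with \<open>g\<close>.\<close>
    let ?K = "\<lambda>y. if 0 \<le> 1 - 2 * snd y then H (fst y, min 1 (2 * snd y))
      else G (fst y, max 0 (2 * snd y - 1))"
    have "pcontinuous_map (pretop_of (sphere_cylinder n)) Z ?K"
    proof (rule pcontinuous_map_glue)
      show "pcontinuous_map (pretop_of (sphere_cylinder n)) Z (\<lambda>y. H (fst y, min 1 (2 * snd y)))"
        by (rule pcontinuous_map_reparametrize[OF H(1)]) (auto intro!: continuous_intros)
      show "pcontinuous_map (pretop_of (sphere_cylinder n)) Z (\<lambda>y. G (fst y, max 0 (2 * snd y - 1)))"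
        by (rule pcontinuous_map_reparametrize[OF G(1)]) (auto intro!: continuous_intros)
      show "continuous_map (sphere_cylinder n) euclideanreal (\<lambda>y. 1 - 2 * snd y)"
        using continuous_map_snd_sphere_cylinder by (intro continuous_intros) auto
    next
      fix y assume "y \<in> topspace (sphere_cylinder n)" "1 - 2 * snd y = (0 :: real)"
      then show "H (fst y, min 1 (2 * snd y)) = G (fst y, max 0 (2 * snd y - 1))"
        using H(3) G(2) by auto
    qed
    then show "(f, h) \<in> based_homotopy_rel n Z z"
      unfolding based_homotopy_rel_iff using fg H(2,4) G(3,4)
      by (intro conjI exI[of _ ?K]) auto
  qed
qed

lemma based_homotopy_rel_compose:
  assumes "pcontinuous_map Z W \<phi>" "\<phi> z = w" "(f, g) \<in> based_homotopy_rel n Z z"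
  shows "(\<phi> \<circ> f, \<phi> \<circ> g) \<in> based_homotopy_rel n W w"
proof -
  obtain H where fg: "f \<in> based_maps n Z z" "g \<in> based_maps n Z z"
    and H: "pcontinuous_map (pretop_of (sphere_cylinder n)) Z H"
      "\<forall>x\<in>topspace (nsphere n). H (x, 0) = f x" "\<forall>x\<in>topspace (nsphere n). H (x, 1) = g x"
      "\<forall>t\<in>{0..1}. H (sphere_base, t) = z"
    using assms(3) by (auto simp: based_homotopy_rel_iff)
  show ?thesis
    unfolding based_homotopy_rel_iff
    using fg H assms(1,2)
    by (intro conjI exI[of _ "\<phi> \<circ> H"]) (auto simp: based_maps_iff intro: pcontinuous_map_compose)
qed

section \<open>The group operation and the induced homomorphisms\<close>

lemma continuous_map_sphere_pinch:
  assumes "1 \<le> n"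
  shows "continuous_map (nsphere n) (nsphere n) (sphere_pinch n)"
proof -
  have *: "continuous_map (nsphere n) (powertop_real UNIV) (sphere_pinch n)"
    unfolding continuous_map_componentwise_UNIV
  proof
    fix k
    show "continuous_map (nsphere n) euclideanreal (\<lambda>x. sphere_pinch n x k)"
      unfolding sphere_pinch_def
      by (cases "k = 0"; cases "k = n")
        (auto intro!: continuous_intros continuous_map_nsphere_projection)
  qed
  have "sphere_pinch n \<in> topspace (nsphere n) \<rightarrow>
      {x. (\<Sum>i\<le>n. (x i)\<^sup>2) = 1 \<and> (\<forall>i>n. x i = 0)}"
    using sphere_pinch_in_psphere[OF assms] by (auto simp: psphere_def nsphere)
  with * have "continuous_map (nsphere n) (subtopology (powertop_real UNIV)
      {x. (\<Sum>i\<le>n. (x i)\<^sup>2) = 1 \<and> (\<forall>i>n. x i = 0)}) (sphere_pinch n)"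
    by (simp only: continuous_map_in_subtopology)
  then show ?thesis
    by (simp only: nsphere[symmetric])
qed

text \<open>The pinch map sends the equator to the base point, where \<open>f\<close> and
  \<open>g\<close> both take the value \<open>z\<close>, so the two hemispheres can be glued. As
  \<open>n\<close> is positive, the base point itself lies on the equator.\<close>

lemma sphere_map_mult_in_based_maps:
  assumes n: "1 \<le> n" and f: "f \<in> based_maps n Z z" and g: "g \<in> based_maps n Z z"
  shows "sphere_map_mult n f g \<in> based_maps n Z z"
proof -
  have pinch: "pcontinuous_map (pretop_of (nsphere n)) (pretop_of (nsphere n)) (sphere_pinch n)"
    by (simp add: pcontinuous_map_pretop_of continuous_map_sphere_pinch[OF n])
  have "pcontinuous_map (pretop_of (nsphere n)) Z
      (\<lambda>x. if 0 \<le> x n then (f \<circ> sphere_pinch n) x else (g \<circ> sphere_pinch n) x)"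
    using f g
    by (intro pcontinuous_map_glue pcontinuous_map_compose[OF pinch] continuous_map_nsphere_projection)
      (auto simp: based_maps_iff sphere_pinch_equator)
  moreover have "sphere_map_mult n f g sphere_base = z"
    using n f by (simp add: sphere_map_mult_def sphere_pinch_equator based_maps_iff sphere_base_def
        [THEN fun_cong, of n])
  ultimately show ?thesis
    unfolding based_maps_iff sphere_map_mult_def[abs_def] comp_def by simp
qed

text \<open>Makes the product of classes well defined. Both homotopies are multiplied at each time
  separately; they match on the equator because they stay at \<open>z\<close> over the base
  point.\<close>

lemma based_homotopy_rel_sphere_map_mult:
  assumes n: "1 \<le> n" and f: "(f, f') \<in> based_homotopy_rel n Z z"
    and g: "(g, g') \<in> based_homotopy_rel n Z z"
  shows "(sphere_map_mult n f g, sphere_map_mult n f' g') \<in> based_homotopy_rel n Z z"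
proof -
  obtain H where H: "pcontinuous_map (pretop_of (sphere_cylinder n)) Z H"
      "\<forall>x\<in>topspace (nsphere n). H (x, 0) = f x" "\<forall>x\<in>topspace (nsphere n). H (x, 1) = f' x"
      "\<forall>t\<in>{0..1}. H (sphere_base, t) = z"
    using f by (auto simp: based_homotopy_rel_iff)
  obtain G where G: "pcontinuous_map (pretop_of (sphere_cylinder n)) Z G"
      "\<forall>x\<in>topspace (nsphere n). G (x, 0) = g x" "\<forall>x\<in>topspace (nsphere n). G (x, 1) = g' x"
      "\<forall>t\<in>{0..1}. G (sphere_base, t) = z"
    using g by (auto simp: based_homotopy_rel_iff)
  \<comment> \<open>The pinch map times the identity of the interval.\<close>
  let ?p = "\<lambda>y. (sphere_pinch n (fst y), snd y)"
  let ?M = "\<lambda>y. if 0 \<le> fst y n then (H \<circ> ?p) y else (G \<circ> ?p) y"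
  have "continuous_map (sphere_cylinder n) (nsphere n) (sphere_pinch n \<circ> fst)"
    by (rule continuous_map_compose[OF continuous_map_fst_sphere_cylinder continuous_map_sphere_pinch[OF n]])
  then have "continuous_map (sphere_cylinder n) (sphere_cylinder n) ?p"
    by (subst (2) sphere_cylinder_def)
      (simp add: continuous_map_pairwise comp_def sphere_cylinder_def continuous_map_snd)
  then have p: "pcontinuous_map (pretop_of (sphere_cylinder n)) (pretop_of (sphere_cylinder n)) ?p"
    by (simp add: pcontinuous_map_pretop_of)
  have "continuous_map (sphere_cylinder n) euclideanreal ((\<lambda>x. x n) \<circ> fst)"
    by (rule continuous_map_compose[OF continuous_map_fst_sphere_cylinder continuous_map_nsphere_projection])
  then have "pcontinuous_map (pretop_of (sphere_cylinder n)) Z ?M"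
    using H G by (intro pcontinuous_map_glue pcontinuous_map_compose[OF p])
      (auto simp: sphere_pinch_equator comp_def)
  moreover have "sphere_pinch n x \<in> topspace (nsphere n)" if "x \<in> topspace (nsphere n)" for x
    using sphere_pinch_in_psphere[OF n, of x] that by (simp add: psphere_def)
  moreover have "sphere_base n = 0"
    using n by (simp add: sphere_base_def)
  ultimately show ?thesis
    unfolding based_homotopy_rel_iff
    using f g H(2-4) G(2-4)
    by (intro conjI sphere_map_mult_in_based_maps[OF n] exI[of _ ?M])
      (auto simp: based_homotopy_rel_iff sphere_map_mult_def sphere_pinch_equator)
qed

text \<open>The union defining \<open>homotopy_map\<close> runs over a constant family, since
  composing with \<open>\<phi>\<close> preserves homotopies. The induced map can thus be computed on
  any representative.\<close>

lemma homotopy_map_class: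
  assumes "pcontinuous_map Z W \<phi>" "\<phi> z = w" "f \<in> based_maps n Z z"
  shows "homotopy_map n W w \<phi> (based_homotopy_rel n Z z `` {f}) = based_homotopy_rel n W w `` {\<phi> \<circ> f}"
proof -
  have eq: "based_homotopy_rel n W w `` {\<phi> \<circ> g} = based_homotopy_rel n W w `` {\<phi> \<circ> f}"
    if "(f, g) \<in> based_homotopy_rel n Z z" for g
    using equiv_class_eq[OF equiv_based_homotopy_rel based_homotopy_rel_compose[OF assms(1,2) that]]
    by simp
  have "f \<in> based_homotopy_rel n Z z `` {f}"
    by (rule equiv_class_self[OF equiv_based_homotopy_rel assms(3)])
  then show ?thesis
    unfolding homotopy_map_def using eq by blast
qed

text \<open>Again all members of the union coincide, by compatibility of the product with
  homotopy.\<close>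

lemma homotopy_group_mult_class:
  assumes "1 \<le> n" "f \<in> based_maps n Z z" "g \<in> based_maps n Z z"
  shows "based_homotopy_rel n Z z `` {f} \<otimes>\<^bsub>homotopy_group n Z z\<^esub> based_homotopy_rel n Z z `` {g}
    = based_homotopy_rel n Z z `` {sphere_map_mult n f g}"
proof -
  have eq: "based_homotopy_rel n Z z `` {sphere_map_mult n f' g'}
      = based_homotopy_rel n Z z `` {sphere_map_mult n f g}"
    if "(f, f') \<in> based_homotopy_rel n Z z" "(g, g') \<in> based_homotopy_rel n Z z" for f' g'
    using equiv_class_eq[OF equiv_based_homotopy_rel
        based_homotopy_rel_sphere_map_mult[OF assms(1) that]] by simp
  have "f \<in> based_homotopy_rel n Z z `` {f}" "g \<in> based_homotopy_rel n Z z `` {g}"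
    by (rule equiv_class_self[OF equiv_based_homotopy_rel], fact)+
  then show ?thesis
    unfolding homotopy_group_def by simp (use eq in blast)
qed

lemma comp_in_based_maps:
  "pcontinuous_map Z W \<phi> \<Longrightarrow> \<phi> z = w \<Longrightarrow> f \<in> based_maps n Z z \<Longrightarrow> \<phi> \<circ> f \<in> based_maps n W w"
  by (auto simp: based_maps_iff intro: pcontinuous_map_compose)

lemma homotopy_map_in_carrier:
  assumes "pcontinuous_map Z W \<phi>" "\<phi> z = w"
  shows "homotopy_map n W w \<phi> \<in> carrier (homotopy_group n Z z) \<rightarrow> carrier (homotopy_group n W w)"
proof
  fix A assume "A \<in> carrier (homotopy_group n Z z)"
  then obtain f where f: "f \<in> based_maps n Z z" "A = based_homotopy_rel n Z z `` {f}"
    by (auto simp: homotopy_group_def quotient_def)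
  then show "homotopy_map n W w \<phi> A \<in> carrier (homotopy_group n W w)"
    using comp_in_based_maps[OF assms f(1)]
    by (simp add: homotopy_map_class[OF assms] homotopy_group_def quotientI)
qed

text \<open>Composition with \<open>\<phi>\<close> commutes strictly with the case distinction in
  \<open>sphere_map_mult\<close>, before passing to homotopy classes.\<close>

lemma homotopy_map_hom:
  assumes n: "1 \<le> n" and \<phi>: "pcontinuous_map Z W \<phi>" "\<phi> z = w"
  shows "homotopy_map n W w \<phi> \<in> hom (homotopy_group n Z z) (homotopy_group n W w)"
proof (rule homI)
  fix A B assume "A \<in> carrier (homotopy_group n Z z)" "B \<in> carrier (homotopy_group n Z z)"
  then obtain f g where f: "f \<in> based_maps n Z z" "A = based_homotopy_rel n Z z `` {f}"
    and g: "g \<in> based_maps n Z z" "B = based_homotopy_rel n Z z `` {g}"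
    by (auto simp: homotopy_group_def quotient_def)
  have "\<phi> \<circ> sphere_map_mult n f g = sphere_map_mult n (\<phi> \<circ> f) (\<phi> \<circ> g)"
    by (auto simp: sphere_map_mult_def fun_eq_iff)
  then show "homotopy_map n W w \<phi> (A \<otimes>\<^bsub>homotopy_group n Z z\<^esub> B)
      = homotopy_map n W w \<phi> A \<otimes>\<^bsub>homotopy_group n W w\<^esub> homotopy_map n W w \<phi> B"
    using f g n \<phi>
    by (simp add: homotopy_group_mult_class homotopy_map_class sphere_map_mult_in_based_maps
        comp_in_based_maps)
qed (use homotopy_map_in_carrier[OF \<phi>] in blast)

section \<open>Maps into the realizations\<close>

text \<open>For a point of the realization this is its carrier, the smallest simplex that contains
  it.\<close>

definition support :: "('a \<Rightarrow> real) \<Rightarrow> 'a set" where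
  "support x = {v. x v \<noteq> 0}"

lemma support_subset: "x \<in> closed_simplex \<sigma> \<Longrightarrow> support x \<subseteq> \<sigma>"
  by (auto simp: support_def closed_simplex_def)

text \<open>The coordinates outside the support vanish, so the sums over \<open>\<sigma>\<close> and
  \<open>\<tau>\<close> both reduce to the sum over the support.\<close>

lemma closed_simplexI_support:
  assumes "x \<in> closed_simplex \<sigma>" "finite \<sigma>" "finite \<tau>" "support x \<subseteq> \<tau>"
  shows "x \<in> closed_simplex \<tau>"
proof -
  have "sum x \<sigma> = sum x (support x)" "sum x \<tau> = sum x (support x)"
    using assms support_subset[OF assms(1)]
    by (auto simp: support_def intro!: sum.mono_neutral_right)
  then show ?thesis
    using assms by (auto simp: closed_simplex_def support_def)
qed

lemma support_nonempty: "x \<in> closed_simplex \<sigma> \<Longrightarrow> support x \<noteq> {}"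
  by (force simp: support_def closed_simplex_def)

lemma clique_complex_finite: "\<sigma> \<in> clique_complex V E \<Longrightarrow> finite \<sigma>"
  by (simp add: clique_complex_def)

lemma clique_complex_subset:
  "\<sigma> \<in> clique_complex V E \<Longrightarrow> \<tau> \<subseteq> \<sigma> \<Longrightarrow> \<tau> \<noteq> {} \<Longrightarrow> \<tau> \<in> clique_complex V E"
  by (auto simp: clique_complex_def intro: finite_subset)

text \<open>This is the flag property: being a clique is a condition on pairs of vertices, and two
  vertices of the union lie in some \<open>A \<union> B\<close>. The case \<open>A = B\<close> shows
  that each member is itself a simplex.\<close>

lemma clique_complex_Union:
  assumes "finite \<A>" "\<A> \<noteq> {}" and pair: "\<And>A B. A \<in> \<A> \<Longrightarrow> B \<in> \<A> \<Longrightarrow> A \<union> B \<in> clique_complex V E"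
  shows "\<Union>\<A> \<in> clique_complex V E"
proof -
  have "A \<in> clique_complex V E" if "A \<in> \<A>" for A
    using pair[OF that that] by simp
  moreover have "(u, v) \<in> E" if "A \<in> \<A>" "B \<in> \<A>" "u \<in> A" "v \<in> B" "u \<noteq> v" for A B u v
    using pair[OF that(1,2)] that(3-) by (auto simp: clique_complex_def)
  ultimately show ?thesis
    using assms(1,2) unfolding clique_complex_def by (auto; blast)
qed

lemma realization_points_support:
  assumes "x \<in> realization_points (clique_complex V E)"
  shows "support x \<in> clique_complex V E" "x \<in> closed_simplex (support x)"
proof -
  obtain \<sigma> where \<sigma>: "\<sigma> \<in> clique_complex V E" "x \<in> closed_simplex \<sigma>"
    using assms by (auto simp: realization_points_def)
  show "support x \<in> clique_complex V E"
    using clique_complex_subset[OF \<sigma>(1) support_subset[OF \<sigma>(2)] support_nonempty[OF \<sigma>(2)]] .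
  then show "x \<in> closed_simplex (support x)"
    using closed_simplexI_support[OF \<sigma>(2)] \<sigma>(1) clique_complex_finite by blast
qed

text \<open>Only points of nonzero weight have to lie in the simplex. This suits a partition of
  unity, where distant centers carry weight zero.\<close>

lemma closed_simplex_convex_combination:
  assumes "finite \<sigma>" "finite D" "\<And>i. i \<in> D \<Longrightarrow> 0 \<le> c i" "sum c D = 1"
    and x: "\<And>i. i \<in> D \<Longrightarrow> c i \<noteq> 0 \<Longrightarrow> x i \<in> closed_simplex \<sigma>"
  shows "(\<lambda>v. \<Sum>i\<in>D. c i * x i v) \<in> closed_simplex \<sigma>"
proof -
  have nonneg: "0 \<le> c i * x i v" if "i \<in> D" for i v
    using assms(3)[OF that] x[OF that] by (cases "c i = 0") (auto simp: closed_simplex_def)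
  have zero: "c i * x i v = 0" if "v \<notin> \<sigma>" "i \<in> D" for i v
    using x[OF that(2)] that(1) by (cases "c i = 0") (auto simp: closed_simplex_def)
  have "c i * sum (x i) \<sigma> = c i" if "i \<in> D" for i
    using x[OF that] by (cases "c i = 0") (auto simp: closed_simplex_def)
  then have "(\<Sum>i\<in>D. c i * sum (x i) \<sigma>) = 1"
    using assms(4) sum.cong[OF refl, of D "\<lambda>i. c i * sum (x i) \<sigma>" c] by simp
  then have "(\<Sum>v\<in>\<sigma>. \<Sum>i\<in>D. c i * x i v) = 1"
    by (subst sum.swap) (simp add: sum_distrib_left)
  moreover have "0 \<le> (\<Sum>i\<in>D. c i * x i v)" for v
    by (rule sum_nonneg) (rule nonneg)
  moreover have "(\<Sum>i\<in>D. c i * x i v) = 0" if "v \<notin> \<sigma>" for v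
    by (rule sum.neutral) (use zero[OF that] in blast)
  ultimately show ?thesis
    by (simp add: closed_simplex_def)
qed

section \<open>Maps into the weak topology and finiteness of supports\<close>

text \<open>Lets sets that are relatively closed in a simplex be treated as closed sets of the
  ambient product space.\<close>

lemma closed_closed_simplex: "closed (closed_simplex \<sigma>)"
proof -
  have "closed_simplex \<sigma> = (\<Inter>v. {x. 0 \<le> x v}) \<inter> (\<Inter>v\<in>-\<sigma>. {x. x v = 0}) \<inter> {x. sum x \<sigma> = 1}"
    by (auto simp: closed_simplex_def)
  moreover have "closed \<dots>"
    by (intro closed_Int closed_INT ballI closed_Collect_le closed_Collect_eq continuous_on_sum
        continuous_on_const continuous_on_product_coordinates)
  ultimately show ?thesis by simp
qed

text \<open>The weak topology may be finer than the product topology, so continuous coordinates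
  alone are not enough. If all supports lie in the finite set \<open>F\<close>, every value lies in
  one of the finitely many simplices contained in \<open>F\<close>, and the preimage of a closed set
  is a finite union of closed sets.\<close>

lemma continuous_map_geometric_realizationI:
  assumes "finite F" and f: "f \<in> topspace T \<rightarrow> realization_points (clique_complex V E)"
    and F: "\<And>x. x \<in> topspace T \<Longrightarrow> support (f x) \<subseteq> F"
    and cont: "\<And>v. continuous_map T euclideanreal (\<lambda>x. f x v)"
  shows "continuous_map T (geometric_realization (clique_complex V E)) f"
  unfolding continuous_map_closedin
proof (intro conjI allI impI)
  let ?K = "clique_complex V E"
  show "f \<in> topspace T \<rightarrow> topspace (geometric_realization ?K)"
    using f by simp
  fix D assume D: "closedin (geometric_realization ?K) D"
  have "continuous_map T (powertop_real UNIV) f"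
    using cont by (simp add: continuous_map_componentwise_UNIV)
  then have contf: "continuous_map T euclidean f"
    by (simp only: euclidean_product_topology)
  have "closedin T {x \<in> topspace T. f x \<in> D \<inter> closed_simplex \<sigma>}" if \<sigma>: "\<sigma> \<in> ?K" for \<sigma>
  proof -
    have sub: "closed_simplex \<sigma> \<subseteq> realization_points ?K"
      using \<sigma> by (auto simp: realization_points_def)
    have "openin (top_of_set (closed_simplex \<sigma>)) ((realization_points ?K - D) \<inter> closed_simplex \<sigma>)"
      using D \<sigma> unfolding closedin_def openin_geometric_realization by auto
    then have "closedin (top_of_set (closed_simplex \<sigma>))
        (closed_simplex \<sigma> - (realization_points ?K - D) \<inter> closed_simplex \<sigma>)"
      by (intro closedin_diff) auto
    also have "closed_simplex \<sigma> - (realization_points ?K - D) \<inter> closed_simplex \<sigma> = D \<inter> closed_simplex \<sigma>"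
      using sub by blast
    finally have "closed (D \<inter> closed_simplex \<sigma>)"
      using closed_closed_simplex closedin_closed_eq by blast
    then show ?thesis
      using closedin_continuous_map_preimage[OF contf, of "D \<inter> closed_simplex \<sigma>"] by simp
  qed
  then have "closedin T (\<Union>\<sigma>\<in>?K \<inter> Pow F. {x \<in> topspace T. f x \<in> D \<inter> closed_simplex \<sigma>})"
    using \<open>finite F\<close> by (intro closedin_Union) auto
  also have "(\<Union>\<sigma>\<in>?K \<inter> Pow F. {x \<in> topspace T. f x \<in> D \<inter> closed_simplex \<sigma>}) = {x \<in> topspace T. f x \<in> D}"
  proof -
    have "support (f x) \<in> ?K \<inter> Pow F" "f x \<in> closed_simplex (support (f x))" if "x \<in> topspace T" for x
      using realization_points_support[of "f x" V E] F[OF that] f that by auto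
    then show ?thesis by blast
  qed
  finally show "closedin T {x \<in> topspace T. f x \<in> D}" .
qed

lemma continuous_map_realization_coordinate:
  "continuous_map (geometric_realization K) euclideanreal (\<lambda>x. x v)"
  unfolding continuous_map_def
proof (intro conjI allI impI)
  fix U :: "real set" assume "openin euclideanreal U"
  then have "open ((\<lambda>x::'a \<Rightarrow> real. x v) -` U)"
    by (intro open_vimage) auto
  moreover have "{x \<in> topspace (geometric_realization K). x v \<in> U} \<inter> closed_simplex \<sigma>
      = closed_simplex \<sigma> \<inter> (\<lambda>x. x v) -` U" if "\<sigma> \<in> K" for \<sigma>
    using that by (auto simp: realization_points_def)
  ultimately show "openin (geometric_realization K) {x \<in> topspace (geometric_realization K). x v \<in> U}"
    by (auto simp: openin_geometric_realization openin_open_Int)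
qed auto

lemma closed_finite_fun:
  fixes D :: "('a \<Rightarrow> real) set"
  assumes "finite D"
  shows "closed D"
proof -
  have "closed {a}" for a :: "'a \<Rightarrow> real"
  proof -
    have "{a} = (\<Inter>v. {x. x v = a v})" by auto
    moreover have "closed \<dots>"
      by (intro closed_INT ballI closed_Collect_eq continuous_on_const continuous_on_product_coordinates)
    ultimately show ?thesis by simp
  qed
  then have "closed (\<Union>a\<in>D. {a})"
    using assms by (intro closed_UN) auto
  then show ?thesis by simp
qed

text \<open>One point of \<open>Q\<close> for every support that occurs gives a set without accumulation points, since a
  simplex has only finitely many faces.\<close>

lemma compactin_geometric_realization_finite_support:
  assumes Q: "compactin (geometric_realization (clique_complex V E)) Q"
  obtains F where "finite F" "\<And>x. x \<in> Q \<Longrightarrow> support x \<subseteq> F"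
proof -
  let ?K = "clique_complex V E"
  define p where "p = inv_into Q support"
  have p: "p \<tau> \<in> Q" "support (p \<tau>) = \<tau>" if "\<tau> \<in> support ` Q" for \<tau>
    using that by (simp_all add: p_def inv_into_into f_inv_into_f)
  define P where "P = p ` support ` Q"
  have QK: "Q \<subseteq> realization_points ?K"
    using compactin_subset_topspace[OF Q] by simp
  have PQ: "P \<subseteq> Q"
    using p by (auto simp: P_def)
  have op: "openin (geometric_realization ?K) (realization_points ?K - D)" if D: "D \<subseteq> P" for D
    unfolding openin_geometric_realization
  proof (intro conjI ballI)
    fix \<sigma> assume \<sigma>: "\<sigma> \<in> ?K"
    have "D \<inter> closed_simplex \<sigma> \<subseteq> p ` Pow \<sigma>"
    proof
      fix x assume x: "x \<in> D \<inter> closed_simplex \<sigma>"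
      then obtain \<tau> where \<tau>: "\<tau> \<in> support ` Q" "x = p \<tau>"
        using D unfolding P_def by blast
      then have "\<tau> \<subseteq> \<sigma>"
        using p(2)[OF \<tau>(1)] support_subset[of x \<sigma>] x by auto
      then show "x \<in> p ` Pow \<sigma>"
        using \<tau>(2) by blast
    qed
    then have "finite (D \<inter> closed_simplex \<sigma>)"
      using clique_complex_finite[OF \<sigma>] finite_subset by blast
    then have "open (- (D \<inter> closed_simplex \<sigma>))"
      by (intro open_Compl closed_finite_fun)
    moreover have "(realization_points ?K - D) \<inter> closed_simplex \<sigma> = closed_simplex \<sigma> \<inter> - (D \<inter> closed_simplex \<sigma>)"
      using \<sigma> by (auto simp: realization_points_def)
    ultimately show "openin (top_of_set (closed_simplex \<sigma>)) ((realization_points ?K - D) \<inter> closed_simplex \<sigma>)"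
      by (simp add: openin_open_Int)
  qed auto
  have "geometric_realization ?K derived_set_of P = {}"
  proof -
    have False if "x \<in> geometric_realization ?K derived_set_of P" (is "x \<in> ?D") for x
    proof -
      have "x \<in> realization_points ?K"
        using that by (simp add: in_derived_set_of)
      \<comment> \<open>An open neighborhood of \<open>x\<close> that contains no point of
        \<open>P\<close> other than possibly \<open>x\<close>.\<close>
      then have "x \<in> realization_points ?K - (P - {x})"
        by simp
      then obtain y where "y \<noteq> x" "y \<in> P" "y \<in> realization_points ?K - (P - {x})"
        using \<open>x \<in> ?D\<close> op[of "P - {x}"] unfolding in_derived_set_of by (meson Diff_subset)
      then show False
        by blast
    qed
    then show ?thesis by blast
  qed
  \<comment> \<open>An infinite subset of the compact set \<open>Q\<close> would have an
    accumulation point.\<close>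
  then have "finite P"
    using compactin_imp_Bolzano_Weierstrass[OF Q, of P] PQ by auto
  moreover have "support x \<in> support ` P" if "x \<in> Q" for x
    using p(2)[of "support x"] that unfolding P_def by (metis imageI)
  moreover have "finite (support x)" if "x \<in> P" for x
    using that PQ QK realization_points_support(1) clique_complex_finite by blast
  ultimately show thesis
    by (intro that[of "\<Union>(support ` P)"]) (simp, blast)
qed

text \<open>By compactness \<open>f\<close> and \<open>g\<close> have all their supports in finite
  sets \<open>F\<close> and \<open>G\<close>. The straight line then has supports in
  \<open>F \<union> G\<close>, and its continuity can be checked on coordinates.\<close>

lemma continuous_map_linear_homotopy:
  assumes T: "compact_space T"
    and f: "continuous_map T (geometric_realization (clique_complex V E)) f"
    and g: "continuous_map T (geometric_realization (clique_complex V E)) g"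
    and common: "\<And>x. x \<in> topspace T \<Longrightarrow> \<exists>\<sigma>\<in>clique_complex V E. f x \<in> closed_simplex \<sigma> \<and> g x \<in> closed_simplex \<sigma>"
  shows "continuous_map (prod_topology T (top_of_set {0..1})) (geometric_realization (clique_complex V E))
           (\<lambda>y v. (1 - snd y) * f (fst y) v + snd y * g (fst y) v)"
proof -
  let ?K = "clique_complex V E" and ?P = "prod_topology T (top_of_set {0..1::real})"
  obtain F where F: "finite F" "\<And>x. x \<in> topspace T \<Longrightarrow> support (f x) \<subseteq> F"
    using compactin_geometric_realization_finite_support[OF image_compactin[OF T[unfolded compact_space_def] f]]
    by (metis imageI)
  obtain G where G: "finite G" "\<And>x. x \<in> topspace T \<Longrightarrow> support (g x) \<subseteq> G"
    using compactin_geometric_realization_finite_support[OF image_compactin[OF T[unfolded compact_space_def] g]]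
    by (metis imageI)
  show ?thesis
  proof (rule continuous_map_geometric_realizationI[of "F \<union> G"])
    show "(\<lambda>y v. (1 - snd y) * f (fst y) v + snd y * g (fst y) v) \<in> topspace ?P \<rightarrow> realization_points ?K"
    proof
      fix y assume y: "y \<in> topspace ?P"
      then obtain \<sigma> where \<sigma>: "\<sigma> \<in> ?K" "f (fst y) \<in> closed_simplex \<sigma>" "g (fst y) \<in> closed_simplex \<sigma>"
        using common by force
      \<comment> \<open>The two-term combination is indexed by \<open>bool\<close>:
        \<open>True\<close> stands for \<open>f\<close>, \<open>False\<close> for
        \<open>g\<close>.\<close>
      have "(\<lambda>v. \<Sum>b\<in>UNIV. (if b then 1 - snd y else snd y) * (if b then f (fst y) else g (fst y)) v)
          \<in> closed_simplex \<sigma>"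
        using y \<sigma> clique_complex_finite[OF \<sigma>(1)]
        by (intro closed_simplex_convex_combination) (auto simp: UNIV_bool)
      then show "(\<lambda>v. (1 - snd y) * f (fst y) v + snd y * g (fst y) v) \<in> realization_points ?K"
        using \<sigma>(1) by (auto simp: realization_points_def UNIV_bool add.commute)
    qed
    show "support (\<lambda>v. (1 - snd y) * f (fst y) v + snd y * g (fst y) v) \<subseteq> F \<union> G" if "y \<in> topspace ?P" for y
    proof -
      have "support (f (fst y)) \<subseteq> F" "support (g (fst y)) \<subseteq> G"
        using F(2)[of "fst y"] G(2)[of "fst y"] that by auto
      then have "f (fst y) v = 0" "g (fst y) v = 0" if "v \<notin> F \<union> G" for v
        using that unfolding support_def by blast+
      then show ?thesis
        unfolding support_def by force
    qed
    show "continuous_map ?P euclideanreal (\<lambda>y. (1 - snd y) * f (fst y) v + snd y * g (fst y) v)" for v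
    proof -
      have "continuous_map ?P euclideanreal snd"
        using continuous_map_snd continuous_map_into_fulltopology by blast
      moreover have "continuous_map ?P euclideanreal (\<lambda>y. f (fst y) v)"
        using continuous_map_compose[OF continuous_map_fst
            continuous_map_compose[OF f continuous_map_realization_coordinate]]
        by (simp add: comp_def)
      moreover have "continuous_map ?P euclideanreal (\<lambda>y. g (fst y) v)"
        using continuous_map_compose[OF continuous_map_fst
            continuous_map_compose[OF g continuous_map_realization_coordinate]]
        by (simp add: comp_def)
      ultimately show ?thesis
        by (intro continuous_intros) auto
    qed
  qed (use F G in auto)
qed

section \<open>Approximating maps into the intermediate realization\<close>

text \<open>At a vertex, each simplex making up the smallest neighborhood contains both that vertex
  and the support of \<open>y\<close>. At any other point the coordinates positive at
  \<open>x\<close> stay positive nearby, so the support of \<open>y\<close> contains that of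
  \<open>x\<close>.\<close>

lemma eventually_support_union_clique:
  assumes x: "x \<in> realization_points (clique_complex V E)"
  shows "eventually (\<lambda>y. support x \<union> support y \<in> clique_complex V E) (nbhd (intermediate_realization V E) x)"
proof (cases "x \<in> vertex_point ` V")
  case True
  then obtain v where v: "x = vertex_point v" by blast
  \<comment> \<open>The neighborhood filter names its vertex only through
    \<open>vertex_point\<close>, hence the need for injectivity.\<close>
  have *: "vertex_point v = vertex_point w \<Longrightarrow> v = w" for w
    by (metis vertex_point_def zero_neq_one)
  have sx: "support x = {v}"
    by (auto simp: support_def vertex_point_def v)
  have "support x \<union> support y \<in> clique_complex V E"
    if "\<sigma> \<in> clique_complex V E" "w \<in> \<sigma>" "x = vertex_point w" "y \<in> closed_simplex \<sigma>" for y \<sigma> w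
    by (rule clique_complex_subset[OF that(1)])
      (use that sx v * support_subset[OF that(4)] in auto)
  then show ?thesis
    using True by (auto simp: intermediate_realization_def eventually_principal)
next
  case False
  let ?K = "clique_complex V E"
  \<comment> \<open>The open star of the carrier of \<open>x\<close>.\<close>
  define U where "U = {y \<in> realization_points ?K. \<forall>v\<in>support x. 0 < y v}"
  note s = realization_points_support[OF x]
  have "open (\<Inter>v\<in>support x. {y :: 'a \<Rightarrow> real. 0 < y v})"
    using clique_complex_finite[OF s(1)]
    by (intro open_INT ballI open_Collect_less continuous_on_const continuous_on_product_coordinates) auto
  moreover have "U \<inter> closed_simplex \<sigma> = closed_simplex \<sigma> \<inter> (\<Inter>v\<in>support x. {y. 0 < y v})"
    if "\<sigma> \<in> ?K" for \<sigma>
    using that by (auto simp: U_def realization_points_def)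
  ultimately have "openin (geometric_realization ?K) U"
    by (auto simp: openin_geometric_realization U_def openin_open_Int)
  moreover have "x \<in> U"
    using x s(2) by (auto simp: U_def support_def closed_simplex_def less_le)
  moreover have "support x \<union> support y \<in> ?K" if "y \<in> U" for y
  proof -
    have "support x \<subseteq> support y"
      using that by (force simp: U_def support_def)
    then show ?thesis
      using realization_points_support(1)[of y V E] that by (simp add: U_def Un_absorb1)
  qed
  ultimately have "eventually (\<lambda>y. support x \<union> support y \<in> ?K) (nhdsin (geometric_realization ?K) x)"
    unfolding eventually_nhdsin by blast
  then show ?thesis
    using False by (simp add: intermediate_realization_def)
qed

text \<open>Continuity of \<open>H\<close> pulls the preceding eventual statement back to the metric
  domain, where a neighborhood contains a relative ball.\<close>

lemma simplicial_radius:
  fixes C :: "'m :: metric_space set"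
  assumes H: "pcontinuous_map (pretop_of (top_of_set C)) (intermediate_realization V E) H" and z: "z \<in> C"
  shows "\<exists>r>0. \<forall>w\<in>C. dist z w < r \<longrightarrow> support (H z) \<union> support (H w) \<in> clique_complex V E"
proof -
  have "H z \<in> realization_points (clique_complex V E)"
    using H z by (auto simp: pcontinuous_map_def intermediate_realization_def)
  from eventually_support_union_clique[OF this]
  have "eventually (\<lambda>w. support (H z) \<union> support (H w) \<in> clique_complex V E) (nhdsin (top_of_set C) z)"
    using H z eventually_compose_filterlim unfolding pcontinuous_map_def by fastforce
  then obtain S where "openin (top_of_set C) S" "z \<in> S"
    and S: "\<forall>w\<in>S. support (H z) \<union> support (H w) \<in> clique_complex V E"
    using z by (auto simp: eventually_nhdsin)
  then obtain r where "r > 0" "ball z r \<inter> C \<subseteq> S"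
    unfolding openin_contains_ball by blast
  then show ?thesis
    using S by (intro exI[of _ r]) auto
qed

text \<open>The set \<open>L\<close> is where \<open>H\<close> has to be left unchanged; it will be
  the line over the base point. The last conclusion provides the straight lines from
  \<open>H\<close> to \<open>G\<close>.\<close>

proposition intermediate_realization_approximation:
  fixes C L :: "'m :: metric_space set"
  assumes "compact C" "closed L"
    and H: "pcontinuous_map (pretop_of (top_of_set C)) (intermediate_realization V E) H"
    and L: "\<And>w. w \<in> C \<inter> L \<Longrightarrow> H w = x0"
  obtains G where "continuous_map (top_of_set C) (geometric_realization (clique_complex V E)) G"
    "\<And>w. w \<in> C \<inter> L \<Longrightarrow> G w = x0"
    "\<And>w. w \<in> C \<Longrightarrow> \<exists>\<sigma>\<in>clique_complex V E. H w \<in> closed_simplex \<sigma> \<and> G w \<in> closed_simplex \<sigma>"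
proof -
  let ?K = "clique_complex V E"
  have HK: "H w \<in> realization_points ?K" if "w \<in> C" for w
    using H that by (auto simp: pcontinuous_map_def intermediate_realization_def)
  \<comment> \<open>The second condition keeps balls centered off \<open>L\<close> away from
    \<open>L\<close>, so that near points of \<open>L\<close> only the wanted centers have weight
    there.\<close>
  have "\<exists>r>0. (\<forall>w\<in>C. dist z w < r \<longrightarrow> support (H z) \<union> support (H w) \<in> ?K) \<and>
      (z \<notin> L \<longrightarrow> (\<forall>w\<in>L. r \<le> dist z w))" if z: "z \<in> C" for z
  proof -
    obtain r where r: "r > 0" "\<forall>w\<in>C. dist z w < r \<longrightarrow> support (H z) \<union> support (H w) \<in> ?K"
      using simplicial_radius[OF H z] by blast
    have "\<exists>d>0. \<forall>w\<in>L. d \<le> dist z w" if "z \<notin> L"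
    proof -
      have "open (- L)" "z \<in> - L"
        using \<open>closed L\<close> that by auto
      then obtain d where d: "d > 0" "ball z d \<subseteq> - L"
        by (meson open_contains_ball)
      then have "d \<le> dist z w" if "w \<in> L" for w
        using that not_less[of "dist z w" d] unfolding mem_ball[symmetric] by blast
      then show ?thesis
        using d(1) by blast
    qed
    \<comment> \<open>For \<open>z\<close> in \<open>L\<close> any positive number will do, and 1 is
      taken.\<close>
    then obtain d where d: "d > 0" "z \<notin> L \<longrightarrow> (\<forall>w\<in>L. d \<le> dist z w)"
      using zero_less_one by blast
    show ?thesis
      using r d by (intro exI[of _ "min r d"]) (auto simp: min.coboundedI2)
  qed
  then obtain r where r: "\<And>z. z \<in> C \<Longrightarrow> r z > 0"
    "\<And>z w. z \<in> C \<Longrightarrow> w \<in> C \<Longrightarrow> dist z w < r z \<Longrightarrow> support (H z) \<union> support (H w) \<in> ?K"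
    "\<And>z w. z \<in> C \<Longrightarrow> z \<notin> L \<Longrightarrow> w \<in> L \<Longrightarrow> r z \<le> dist z w"
    by metis
  obtain D where D: "D \<subseteq> C" "finite D" "C \<subseteq> (\<Union>z\<in>D. ball z (r z / 2))"
    by (rule compactE_image[OF \<open>compact C\<close>, of C "\<lambda>z. ball z (r z / 2)"])
      (use r(1) in \<open>auto intro!: bexI[rotated]\<close>)
  \<comment> \<open>Tent functions that are positive exactly on the balls of half radius; dividing
    by their sum \<open>s\<close> gives the partition of unity.\<close>
  define \<rho> where "\<rho> z w = max 0 (r z / 2 - dist z w)" for z w
  define s where "s w = (\<Sum>z\<in>D. \<rho> z w)" for w
  define G where "G w = (\<lambda>v. \<Sum>z\<in>D. (\<rho> z w / s w) * H z v)" for w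
  have \<rho>_nonneg: "0 \<le> \<rho> z w" for z w
    by (simp add: \<rho>_def)
  have s_pos: "s w > 0" if w: "w \<in> C" for w
  proof -
    obtain z where "z \<in> D" "dist z w < r z / 2"
      using D(3) w by auto
    then show ?thesis
      unfolding s_def using D(2) \<rho>_nonneg by (intro sum_pos2[of _ z]) (auto simp: \<rho>_def)
  qed
  have weights: "(\<Sum>z\<in>D. \<rho> z w / s w) = 1" if "w \<in> C" for w
    using s_pos[OF that] by (simp flip: sum_divide_distrib s_def)
  have near: "dist z w < r z / 2" if "\<rho> z w \<noteq> 0" for z w
    using that by (auto simp: \<rho>_def max_def split: if_splits)
  have common: "\<exists>\<sigma>\<in>?K. H w \<in> closed_simplex \<sigma> \<and> G w \<in> closed_simplex \<sigma>" if w: "w \<in> C" for w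
  proof -
    define I where "I = {z \<in> D. \<rho> z w \<noteq> 0}"
    \<comment> \<open>The carriers of \<open>H w\<close> and of the centers contributing at
      \<open>w\<close>; once they are pairwise compatible, \<open>clique_complex_Union\<close>
      yields one simplex.\<close>
    define \<A> where "\<A> = insert (support (H w)) ((\<lambda>z. support (H z)) ` I)"
    have Iw: "support (H z) \<union> support (H w) \<in> ?K" if "z \<in> I" for z
      using that near[of z w] r(1,2)[of z] D(1) w by (force simp: I_def)
    have II: "support (H y) \<union> support (H z) \<in> ?K" if "y \<in> I" "z \<in> I" "r z \<le> r y" for y z
    proof -
      \<comment> \<open>Here the half radii matter: \<open>dist y z\<close> is at most
        \<open>dist y w + dist z w\<close>, which is below \<open>r y / 2 + r z / 2\<close> and so
        below \<open>r y\<close>.\<close>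
      have "dist y z < r y"
        using that near[of y w] near[of z w] dist_triangle2[of y z w] by (auto simp: I_def)
      then show ?thesis
        using that D(1) r(2)[of y z] by (auto simp: I_def)
    qed
    have II': "support (H y) \<union> support (H z) \<in> ?K" if "y \<in> I" "z \<in> I" for y z
      using II[OF that] II[OF that(2,1)] by (cases "r z \<le> r y") (auto simp: Un_commute)
    have "A \<union> B \<in> ?K" if "A \<in> \<A>" "B \<in> \<A>" for A B
    proof -
      have "support (H w) \<union> support (H z) \<in> ?K" if "z \<in> I" for z
        using Iw[OF that] by (simp only: Un_commute)
      then show ?thesis
        using that Iw II' realization_points_support(1)[OF HK[OF w]]
        unfolding \<A>_def by (elim insertE imageE) simp_all
    qed
    moreover have "finite \<A>" "\<A> \<noteq> {}"
      using D(2) by (simp_all add: \<A>_def I_def)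
    ultimately have \<sigma>: "\<Union>\<A> \<in> ?K"
      by (metis clique_complex_Union)
    have in\<sigma>: "H z \<in> closed_simplex (\<Union>\<A>)" if "z \<in> C" "support (H z) \<in> \<A>" for z
      using realization_points_support[OF HK[OF that(1)]] clique_complex_finite[OF \<sigma>] Union_upper[OF that(2)]
      by (metis closed_simplexI_support clique_complex_finite)
    have "G w \<in> closed_simplex (\<Union>\<A>)"
      unfolding G_def
    proof (rule closed_simplex_convex_combination)
      fix z assume "z \<in> D" "\<rho> z w / s w \<noteq> 0"
      then show "H z \<in> closed_simplex (\<Union>\<A>)"
        using D(1) by (intro in\<sigma>) (auto simp: \<A>_def I_def)
    qed (use clique_complex_finite[OF \<sigma>] D(2) weights[OF w] \<rho>_nonneg less_imp_le[OF s_pos[OF w]] in auto)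
    moreover have "H w \<in> closed_simplex (\<Union>\<A>)"
      by (rule in\<sigma>[OF w]) (simp add: \<A>_def)
    ultimately show ?thesis
      using \<sigma> by blast
  qed
  show thesis
  proof
    show "continuous_map (top_of_set C) (geometric_realization ?K) G"
    \<comment> \<open>The finitely many centers provide a finite vertex set containing all supports
      of \<open>G\<close>.\<close>
    proof (rule continuous_map_geometric_realizationI[of "\<Union>z\<in>D. support (H z)"])
      show "finite (\<Union>z\<in>D. support (H z))"
        using D(1,2) HK realization_points_support(1) clique_complex_finite by blast
      show "G \<in> topspace (top_of_set C) \<rightarrow> realization_points ?K"
        using common unfolding realization_points_def topspace_euclidean_subtopology by blast
      show "support (G w) \<subseteq> (\<Union>z\<in>D. support (H z))" for w
      proof
        fix v assume "v \<in> support (G w)"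
        then have "(\<Sum>z\<in>D. (\<rho> z w / s w) * H z v) \<noteq> 0"
          by (simp add: support_def G_def)
        then obtain z where "z \<in> D" "(\<rho> z w / s w) * H z v \<noteq> 0"
          by (rule sum.not_neutral_contains_not_neutral)
        then show "v \<in> (\<Union>z\<in>D. support (H z))"
          by (auto simp: support_def)
      qed
      show "continuous_map (top_of_set C) euclideanreal (\<lambda>w. G w v)" for v
      proof -
        have "s w \<noteq> 0" if "w \<in> C" for w
          using s_pos[OF that] by simp
        then have "continuous_on C (\<lambda>w. \<Sum>z\<in>D. (\<rho> z w / s w) * H z v)"
          unfolding \<rho>_def s_def by (intro continuous_intros) auto
        then show ?thesis
          by (simp add: G_def)
      qed
    qed
    show "G w = x0" if w: "w \<in> C \<inter> L" for w
    proof
      fix v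
      have "(\<rho> z w / s w) * H z v = (\<rho> z w / s w) * x0 v" if z: "z \<in> D" for z
      proof (cases "\<rho> z w = 0")
        case False
        \<comment> \<open>Otherwise \<open>r z \<le> dist z w < r z / 2\<close>, contradicting
          \<open>r z > 0\<close>. Hence every contributing center has
          \<open>H z = x0\<close>.\<close>
        then have "z \<in> L"
          using near[OF False] r(1)[of z] r(3)[of z w] z D(1) w by force
        then show ?thesis
          using L[of z] z D(1) by auto
      qed simp
      then have "G w v = (\<Sum>z\<in>D. \<rho> z w / s w) * x0 v"
        unfolding G_def sum_distrib_right by (rule sum.cong[OF refl])
      then show "G w v = x0 v"
        using weights w by simp
    qed
  qed (use common in blast)
qed

section \<open>Comparing homotopies in the two realizations\<close>

text \<open>Passes from the product topology to the type class topology of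
  \<open>nat \<Rightarrow> real\<close>, which is a metric space because \<open>nat\<close> is
  countable. The approximation is stated for metric domains.\<close>

lemma nsphere_eq_top_of_set: "nsphere n = top_of_set (topspace (nsphere n))"
  by (simp add: nsphere euclidean_product_topology)

text \<open>The sphere is a closed subset of an infinite product of intervals, which is compact by
  Tychonoff.\<close>

lemma compact_topspace_nsphere: "compact (topspace (nsphere n))"
proof -
  let ?S = "{x. (\<Sum>i\<le>n. (x i)\<^sup>2) = 1 \<and> (\<forall>i>n. x i = 0)} :: (nat \<Rightarrow> real) set"
  have "compactin (powertop_real UNIV) (PiE UNIV (\<lambda>i. {-1..1}))"
    by (simp add: compactin_PiE)
  then have *: "compact (PiE (UNIV :: nat set) (\<lambda>i. {-1..1::real}))"
    by (simp add: euclidean_product_topology)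
  have "\<bar>x i\<bar> \<le> 1" if "x \<in> ?S" for x i
  proof (cases "i \<le> n")
    case True
    then have "(x i)\<^sup>2 \<le> (\<Sum>i\<le>n. (x i)\<^sup>2)"
      by (intro member_le_sum) auto
    then show ?thesis
      using that by (simp add: abs_square_le_1)
  qed (use that in auto)
  then have "?S \<subseteq> PiE UNIV (\<lambda>i. {-1..1})"
    by (force simp: abs_le_iff)
  moreover have "?S = {x. (\<Sum>i\<le>n. (x i)\<^sup>2) = 1} \<inter> (\<Inter>i\<in>{n<..}. {x. x i = 0})"
    by auto
  moreover have "closed \<dots>"
    by (intro closed_Int closed_INT ballI closed_Collect_eq continuous_on_sum continuous_on_power
        continuous_on_const continuous_on_product_coordinates)
  ultimately have "compact ?S"
    using compact_Int_closed[OF *, of ?S] by (simp add: inf.absorb2)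
  then show ?thesis
    by (simp add: nsphere)
qed

lemma sphere_cylinder_eq_top_of_set:
  "sphere_cylinder n = top_of_set (topspace (nsphere n) \<times> {0..1})"
  unfolding sphere_cylinder_def
  by (subst nsphere_eq_top_of_set) (simp del: topspace_sphere_cylinder)

lemma based_maps_clique_realization_iff:
  "f \<in> based_maps n (clique_realization V E) x0 \<longleftrightarrow>
     continuous_map (nsphere n) (geometric_realization (clique_complex V E)) f \<and> f sphere_base = x0"
  by (simp add: based_maps_iff clique_realization_def pcontinuous_map_pretop_of)

text \<open>The straight-line homotopy is based since both ends have the value \<open>x0\<close> at
  the base point.\<close>

lemma based_homotopy_rel_linear:
  assumes f: "f \<in> based_maps n (clique_realization V E) x0"
    and g: "g \<in> based_maps n (clique_realization V E) x0"
    and "\<And>x. x \<in> topspace (nsphere n) \<Longrightarrow>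
      \<exists>\<sigma>\<in>clique_complex V E. f x \<in> closed_simplex \<sigma> \<and> g x \<in> closed_simplex \<sigma>"
  shows "(f, g) \<in> based_homotopy_rel n (clique_realization V E) x0"
proof -
  let ?H = "\<lambda>y v. (1 - snd y) * f (fst y) v + snd y * g (fst y) v"
  have "compact_space (nsphere n)"
    using compact_topspace_nsphere
    by (subst nsphere_eq_top_of_set) (simp add: compact_space_subtopology)
  then have "continuous_map (sphere_cylinder n) (geometric_realization (clique_complex V E)) ?H"
    unfolding sphere_cylinder_def
    using assms by (intro continuous_map_linear_homotopy) (auto simp: based_maps_clique_realization_iff)
  then have "pcontinuous_map (pretop_of (sphere_cylinder n)) (clique_realization V E) ?H"
    by (simp add: clique_realization_def pcontinuous_map_pretop_of)
  moreover have "f sphere_base = x0" "g sphere_base = x0"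
    using f g by (auto simp: based_maps_iff)
  ultimately show ?thesis
    unfolding based_homotopy_rel_iff using f g
    by (intro conjI exI[of _ ?H]) (auto simp: algebra_simps)
qed

text \<open>The approximation \<open>G\<close> of the given homotopy joins two maps that differ from
  \<open>f\<close> and \<open>g\<close> by straight lines; transitivity combines the three
  homotopies.\<close>

lemma based_homotopy_rel_intermediate_imp_clique:
  assumes f: "f \<in> based_maps n (clique_realization V E) x0"
    and g: "g \<in> based_maps n (clique_realization V E) x0"
    and rel: "(f, g) \<in> based_homotopy_rel n (intermediate_realization V E) x0"
  shows "(f, g) \<in> based_homotopy_rel n (clique_realization V E) x0"
proof -
  let ?K = "clique_complex V E" and ?C = "topspace (nsphere n) \<times> {0..1::real}"
  obtain H where H: "pcontinuous_map (pretop_of (sphere_cylinder n)) (intermediate_realization V E) H"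
    and H0: "\<forall>x\<in>topspace (nsphere n). H (x, 0) = f x" and H1: "\<forall>x\<in>topspace (nsphere n). H (x, 1) = g x"
    and Hb: "\<forall>t\<in>{0..1}. H (sphere_base, t) = x0"
    using rel by (auto simp: based_homotopy_rel_iff)
  have "compact ?C"
    by (intro compact_Times compact_topspace_nsphere compact_Icc)
  \<comment> \<open>The closed line over the base point is the set \<open>L\<close> of the
    approximation.\<close>
  moreover have "closed ({sphere_base} \<times> (UNIV :: real set))"
    by (intro closed_Times closed_singleton closed_UNIV)
  ultimately obtain G where G: "continuous_map (top_of_set ?C) (geometric_realization ?K) G"
    and Gb: "\<And>w. w \<in> ?C \<inter> ({sphere_base} \<times> UNIV) \<Longrightarrow> G w = x0"
    and common: "\<And>w. w \<in> ?C \<Longrightarrow> \<exists>\<sigma>\<in>?K. H w \<in> closed_simplex \<sigma> \<and> G w \<in> closed_simplex \<sigma>"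
    by (rule intermediate_realization_approximation[OF _ _ H[unfolded sphere_cylinder_eq_top_of_set]])
      (use Hb in auto)
  have Gc: "continuous_map (sphere_cylinder n) (geometric_realization ?K) G"
    using G by (simp add: sphere_cylinder_eq_top_of_set)
  have Gb': "G (sphere_base, t) = x0" if "t \<in> {0..1}" for t
    using that sphere_base_in_nsphere by (intro Gb) auto
  have sym: "sym (based_homotopy_rel n (clique_realization V E) x0)"
    and trans: "trans (based_homotopy_rel n (clique_realization V E) x0)"
    using equiv_based_homotopy_rel[of n "clique_realization V E" x0] by (simp_all add: equiv_def)
  have ends: "(\<lambda>x. G (x, t)) \<in> based_maps n (clique_realization V E) x0" if t: "t \<in> {0..1}" for t
  proof -
    have "continuous_map (nsphere n) (sphere_cylinder n) (\<lambda>x. (x, t))"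
      unfolding sphere_cylinder_def using t by (intro continuous_map_pairedI) auto
    then show ?thesis
      using continuous_map_compose[OF _ Gc] Gb'[OF t]
      by (fastforce simp: based_maps_clique_realization_iff comp_def)
  qed
  have "(f, \<lambda>x. G (x, 0)) \<in> based_homotopy_rel n (clique_realization V E) x0"
  proof (intro based_homotopy_rel_linear f ends)
    show "\<exists>\<sigma>\<in>?K. f x \<in> closed_simplex \<sigma> \<and> G (x, 0) \<in> closed_simplex \<sigma>"
      if "x \<in> topspace (nsphere n)" for x
      using common[of "(x, 0)"] H0 that by simp
  qed simp
  moreover have "(\<lambda>x. G (x, 0), \<lambda>x. G (x, 1)) \<in> based_homotopy_rel n (clique_realization V E) x0"
    unfolding based_homotopy_rel_iff using Gc Gb'
    by (intro conjI ends exI[of _ G]) (simp_all add: clique_realization_def pcontinuous_map_pretop_of)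
  moreover have "(\<lambda>x. G (x, 1), g) \<in> based_homotopy_rel n (clique_realization V E) x0"
  proof (rule symD[OF sym], intro based_homotopy_rel_linear g ends)
    show "\<exists>\<sigma>\<in>?K. g x \<in> closed_simplex \<sigma> \<and> G (x, 1) \<in> closed_simplex \<sigma>"
      if "x \<in> topspace (nsphere n)" for x
      using common[of "(x, 1)"] H1 that by simp
  qed simp
  ultimately show ?thesis
    using trans by (meson transD)
qed

theorem proposition2p6:
  fixes V :: "'a set" and E :: "('a \<times> 'a) set" and n :: nat and x0 :: "'a \<Rightarrow> real"
  assumes "reflexive_graph V E"
    and "x0 \<in> realization_points (clique_complex V E)"
  shows "homotopy_map n (intermediate_realization V E) x0 id
           \<in> carrier (homotopy_group n (clique_realization V E) x0) \<rightarrow> carrier (homotopy_group n (intermediate_realization V E) x0)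
       \<and> inj_on (homotopy_map n (intermediate_realization V E) x0 id) (carrier (homotopy_group n (clique_realization V E) x0))
       \<and> (1 \<le> n \<longrightarrow> homotopy_map n (intermediate_realization V E) x0 id
                      \<in> mon (homotopy_group n (clique_realization V E) x0) (homotopy_group n (intermediate_realization V E) x0))"
proof -
  let ?Z = "clique_realization V E" and ?W = "intermediate_realization V E"
  note id = pcontinuous_map_id_KR[of V E] id_apply[of x0]
  have inj: "inj_on (homotopy_map n ?W x0 id) (carrier (homotopy_group n ?Z x0))"
  proof (rule inj_onI)
    fix A B assume "A \<in> carrier (homotopy_group n ?Z x0)" "B \<in> carrier (homotopy_group n ?Z x0)"
      and eq: "homotopy_map n ?W x0 id A = homotopy_map n ?W x0 id B"
    then obtain f g where f: "f \<in> based_maps n ?Z x0" "A = based_homotopy_rel n ?Z x0 `` {f}"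
      and g: "g \<in> based_maps n ?Z x0" "B = based_homotopy_rel n ?Z x0 `` {g}"
      by (auto simp: homotopy_group_def quotient_def)
    \<comment> \<open>As the underlying map is the identity, \<open>f\<close> and \<open>g\<close>
      also represent the image classes.\<close>
    have "based_homotopy_rel n ?W x0 `` {f} = based_homotopy_rel n ?W x0 `` {g}"
      using eq homotopy_map_class[OF id f(1)] homotopy_map_class[OF id g(1)] f(2) g(2)
      by (simp only: id_comp)
    then have "(f, g) \<in> based_homotopy_rel n ?W x0"
      using eq_equiv_class[OF _ equiv_based_homotopy_rel] comp_in_based_maps[OF id g(1)]
      by (simp only: id_comp)
    then have "(f, g) \<in> based_homotopy_rel n ?Z x0"
      by (rule based_homotopy_rel_intermediate_imp_clique[OF f(1) g(1)])
    then show "A = B"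
      unfolding f(2) g(2) by (rule equiv_class_eq[OF equiv_based_homotopy_rel])
  qed
  moreover have "homotopy_map n ?W x0 id \<in> carrier (homotopy_group n ?Z x0) \<rightarrow> carrier (homotopy_group n ?W x0)"
    by (rule homotopy_map_in_carrier) (rule id)+
  moreover have "homotopy_map n ?W x0 id \<in> hom (homotopy_group n ?Z x0) (homotopy_group n ?W x0)" if "1 \<le> n"
    by (rule homotopy_map_hom[OF that]) (rule id)+
  ultimately show ?thesis
    by (simp add: mon_def)
qed

end
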